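(* Let $\mathcal{F}$ be a variety with the congruence-product property and let $S \in \mathcal{F}$ be finite. Let $G$ be an $\mathcal{F}$-linear cellular automaton on $S^{\mathbb{Z}}$ with limit set $X$. Then $G$ is stable, and $X$ is algebraically conjugate to a product of full shifts: there are finite algebras $R_1,\dots,R_m \in \mathcal{F}$ and an algebraic conjugacy $\phi : X \to \prod_{i=1}^m R_i^{\mathbb{Z}}$. Furthermore, there exists an integer $p \geq 1$ such that $G^p|_X$ is a product of powers of shift maps, i.e. $\phi$ can be chosen so that, for some $k_1,\dots,k_m \in \mathbb{Z}$, $\phi \circ G^p|_X \circ \phi^{-1} = \sigma_{R_1}^{k_1} \times \cdots \times \sigma_{R_m}^{k_m}$.
   Context: A variety of a given type (a set of operation symbols with finite arities) is the class of all algebras of that type satisfying a given set of identities; homomorphisms between algebras in $\mathcal{F}$ are called $\mathcal{F}$-morphisms. For an algebra $A$, $\mathrm{Con}(A)$ is the set of congruences on $A$. The variety $\mathcal{F}$ has the congruence-product property if for all finite families $(S_i)_{i\in[1,n]}$ of algebras in $\mathcal{F}$ we have $\mathrm{Con}(\prod_{i=1}^n S_i) = \prod_{i=1}^n \mathrm{Con}(S_i)$, where a tuple $(\sim_i)_i$ of congruences is identified with the congruence on the product given by $s \sim t \iff s_i \sim_i t_i$ for all $i$ (so the condition says every congruence on the product is of this form). For finite $S\in\mathcal{F}$, the full shift $S^{\mathbb{Z}}$ carries the cellwise algebra structure $f(x^1,\dots,x^n)_i = f(x^1_i,\dots,x^n_i)$, and subshifts that are subalgebras inherit it. The shift map is $\sigma_S(x)_i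 = x_{i+1}$. A cellular automaton on $S^{\mathbb{Z}}$ is a continuous map $G:S^{\mathbb{Z}}\to S^{\mathbb{Z}}$ commuting with $\sigma_S$; it is $\mathcal{F}$-linear if it is also an $\mathcal{F}$-morphism. Its limit set is $\bigcap_{n\ge 0} G^n(S^{\mathbb{Z}})$, and $G$ is stable if the limit set equals $G^n(S^{\mathbb{Z}})$ for some $n$. A conjugacy is a bijective continuous shift-commuting map between subshifts; it is algebraic if it is also an $\mathcal{F}$-morphism. A product of full shifts $\prod_i R_i^{\mathbb{Z}}$ is regarded as the full shift $(\prod_i R_i)^{\mathbb{Z}}$ with cellwise operations. *)

theory Defs
  imports "HOL-Analysis.Analysis"
begin

section \<open>Algebras and varieties\<close>

text \<open>
  A type of algebras is a partial map: the operation symbols are the elements of its domain, and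
  \<open>ar f = Some n\<close> means that \<open>f\<close> has arity \<open>n\<close>.  In this way the set of symbols may be empty.
  Values of \<open>interp\<close> are only relevant on symbols of the type and on argument
  lists of the right length over the universe.  Algebras with empty universe are permitted
  (when there is no constant symbol).
\<close>

type_synonym 'f signature = "'f \<Rightarrow> nat option"

record ('f, 'a) ualgebra =
  universe :: "'a set"
  interp :: "'f \<Rightarrow> 'a list \<Rightarrow> 'a"

definition is_algebra :: "'f signature \<Rightarrow> ('f, 'a) ualgebra \<Rightarrow> bool" where
  "is_algebra ar A \<longleftrightarrow>
     (\<forall>f n xs. ar f = Some n \<and> length xs = n \<and> set xs \<subseteq> universe A \<longrightarrow> interp A f xs \<in> universe A)"

datatype ('f, 'v) trm = Var 'v | App 'f "('f, 'v) trm list"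

fun wf_trm :: "'f signature \<Rightarrow> ('f, 'v) trm \<Rightarrow> bool" where
  "wf_trm ar (Var x) \<longleftrightarrow> True"
| "wf_trm ar (App f ts) \<longleftrightarrow> ar f = Some (length ts) \<and> (\<forall>t\<in>set ts. wf_trm ar t)"

primrec trm_value :: "('f, 'a) ualgebra \<Rightarrow> ('v \<Rightarrow> 'a) \<Rightarrow> ('f, 'v) trm \<Rightarrow> 'a" where
  "trm_value A v (Var x) = v x"
| "trm_value A v (App f ts) = interp A f (map (trm_value A v) ts)"

type_synonym 'f identity = "('f, nat) trm \<times> ('f, nat) trm"

definition wf_identities :: "'f signature \<Rightarrow> 'f identity set \<Rightarrow> bool" where
  "wf_identities ar E \<longleftrightarrow> (\<forall>(s, t)\<in>E. wf_trm ar s \<and> wf_trm ar t)"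

definition satisfies :: "('f, 'a) ualgebra \<Rightarrow> 'f identity \<Rightarrow> bool" where
  "satisfies A e \<longleftrightarrow>
     (\<forall>v. range v \<subseteq> universe A \<longrightarrow> trm_value A v (fst e) = trm_value A v (snd e))"

definition in_variety :: "'f signature \<Rightarrow> 'f identity set \<Rightarrow> ('f, 'a) ualgebra \<Rightarrow> bool" where
  "in_variety ar E A \<longleftrightarrow> is_algebra ar A \<and> (\<forall>e\<in>E. satisfies A e)"

definition morphism ::
    "'f signature \<Rightarrow> ('f, 'a) ualgebra \<Rightarrow> ('f, 'b) ualgebra \<Rightarrow> ('a \<Rightarrow> 'b) \<Rightarrow> bool" where
  "morphism ar A B h \<longleftrightarrow>
     h ` universe A \<subseteq> universe B \<and>
     (\<forall>f n xs. ar f = Some n \<and> length xs = n \<and> set xs \<subseteq> universe A \<longrightarrow>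
        h (interp A f xs) = interp B f (map h xs))"

definition subalgebra :: "'f signature \<Rightarrow> ('f, 'a) ualgebra \<Rightarrow> 'a set \<Rightarrow> bool" where
  "subalgebra ar A X \<longleftrightarrow> X \<subseteq> universe A \<and> is_algebra ar (A\<lparr>universe := X\<rparr>)"


section \<open>Products and the congruence-product property\<close>

definition direct_product :: "('f, 'a) ualgebra list \<Rightarrow> ('f, 'a list) ualgebra" where
  "direct_product As =
     \<lparr>universe = {x. length x = length As \<and> (\<forall>i<length As. x ! i \<in> universe (As ! i))},
      interp = (\<lambda>f xs. map (\<lambda>i. interp (As ! i) f (map (\<lambda>x. x ! i) xs)) [0..<length As])\<rparr>"

definition congruences :: "'f signature \<Rightarrow> ('f, 'a) ualgebra \<Rightarrow> ('a \<times> 'a) set set" where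
  "congruences ar A =
     {r. equiv (universe A) r \<and>
         (\<forall>f n xs ys. ar f = Some n \<and> length xs = n \<and> (xs, ys) \<in> listrel r \<longrightarrow>
            (interp A f xs, interp A f ys) \<in> r)}"

definition prod_congruence ::
    "('f, 'a) ualgebra list \<Rightarrow> ('a \<times> 'a) set list \<Rightarrow> ('a list \<times> 'a list) set" where
  "prod_congruence As rs =
     {(s, t). s \<in> universe (direct_product As) \<and> t \<in> universe (direct_product As) \<and>
              (\<forall>i<length As. (s ! i, t ! i) \<in> rs ! i)}"

definition congruences_factor :: "'f signature \<Rightarrow> ('f, 'a) ualgebra list \<Rightarrow> bool" where
  "congruences_factor ar As \<longleftrightarrow>
     congruences ar (direct_product As) =
     {prod_congruence As rs |rs.
        length rs = length As \<and> (\<forall>i<length As. rs ! i \<in> congruences ar (As ! i))}"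

text \<open>
  HOL cannot quantify over the carrier types of the members of a variety inside a definition, so
  the families range over algebras whose elements are terms.  This is no restriction: the lemma
  \<open>congruence_product_propertyD\<close> below derives the property for families of algebras
  over an arbitrary type.
\<close>

definition congruence_product_property :: "'f signature \<Rightarrow> 'f identity set \<Rightarrow> bool" where
  "congruence_product_property ar E \<longleftrightarrow>
     (\<forall>As :: ('f, ('f, nat) trm) ualgebra list.
        (\<forall>A\<in>set As. in_variety ar E A) \<longrightarrow> congruences_factor ar As)"


subsection \<open>Independence of the carrier type\<close>

definition trm_rep :: "'f signature \<Rightarrow> ('f, 'a) ualgebra \<Rightarrow> (nat \<Rightarrow> 'a) \<Rightarrow> 'a \<Rightarrow> ('f, nat) trm" where
  "trm_rep ar A v b = (SOME t. wf_trm ar t \<and> trm_value A v t = b)"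

text \<open>A copy, with terms as elements, of the subalgebra of \<open>A\<close> generated by the range of \<open>v\<close>.\<close>

definition trm_model ::
    "'f signature \<Rightarrow> ('f, 'a) ualgebra \<Rightarrow> (nat \<Rightarrow> 'a) \<Rightarrow> ('f, ('f, nat) trm) ualgebra" where
  "trm_model ar A v =
     \<lparr>universe = trm_rep ar A v ` trm_value A v ` {t. wf_trm ar t},
      interp = (\<lambda>f ts. trm_rep ar A v (interp A f (map (trm_value A v) ts)))\<rparr>"

lemma trm_rep:
  assumes "b \<in> trm_value A v ` {t. wf_trm ar t}"
  shows "wf_trm ar (trm_rep ar A v b)" "trm_value A v (trm_rep ar A v b) = b"
proof -
  have "\<exists>t. wf_trm ar t \<and> trm_value A v t = b" using assms by auto
  from someI_ex[OF this] show "wf_trm ar (trm_rep ar A v b)" "trm_value A v (trm_rep ar A v b) = b"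
    unfolding trm_rep_def by auto
qed

lemma trm_modelD:
  assumes "t \<in> universe (trm_model ar A v)"
  shows "wf_trm ar t" "trm_rep ar A v (trm_value A v t) = t"
  using assms trm_rep[of _ A v ar] by (auto simp: trm_model_def)

lemma trm_value_in_universe:
  assumes "is_algebra ar A" "range v \<subseteq> universe A" "wf_trm ar t"
  shows "trm_value A v t \<in> universe A"
  using assms(3)
proof (induction t)
  case (App f ts)
  then show ?case using assms(1) by (auto simp: is_algebra_def image_subset_iff)
qed (use assms in auto)

lemma trm_model_interp:
  assumes "ar f = Some (length ts)" "set ts \<subseteq> universe (trm_model ar A v)"
  shows "interp (trm_model ar A v) f ts \<in> universe (trm_model ar A v)"
    and "trm_value A v (interp (trm_model ar A v) f ts) = interp A f (map (trm_value A v) ts)"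
proof -
  have "wf_trm ar (App f ts)" using assms trm_modelD(1) by fastforce
  then have *: "interp A f (map (trm_value A v) ts) \<in> trm_value A v ` {t. wf_trm ar t}"
    by (metis (mono_tags, lifting) image_eqI mem_Collect_eq trm_value.simps(2))
  show "interp (trm_model ar A v) f ts \<in> universe (trm_model ar A v)"
    using * by (simp add: trm_model_def)
  show "trm_value A v (interp (trm_model ar A v) f ts) = interp A f (map (trm_value A v) ts)"
    using trm_rep(2)[OF *] by (simp add: trm_model_def)
qed

lemma trm_model_value:
  assumes "range w \<subseteq> universe (trm_model ar A v)" "wf_trm ar t"
  shows "trm_value (trm_model ar A v) w t \<in> universe (trm_model ar A v) \<and>
         trm_value A v (trm_value (trm_model ar A v) w t) = trm_value A (\<lambda>x. trm_value A v (w x)) t"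
  using assms(2)
proof (induction t)
  case (Var x)
  then show ?case using assms(1) by auto
next
  case (App f ts)
  let ?us = "map (trm_value (trm_model ar A v) w) ts"
  have "set ?us \<subseteq> universe (trm_model ar A v)" using App by auto
  moreover have "ar f = Some (length ?us)" using App by simp
  moreover have "map (trm_value A v) ?us = map (trm_value A (\<lambda>x. trm_value A v (w x))) ts"
    using App by auto
  ultimately show ?case
    using trm_model_interp[of ar f ?us A v] by (simp del: map_map)
qed

lemma trm_model_in_variety:
  fixes A :: "('f, 'a) ualgebra"
  assumes E: "wf_identities ar E" and A: "in_variety ar E A" and v: "range v \<subseteq> universe A"
  shows "in_variety ar E (trm_model ar A v)"
  unfolding in_variety_def
proof
  let ?M = "trm_model ar A v"
  show "is_algebra ar ?M"
    unfolding is_algebra_def by (intro allI impI trm_model_interp(1)) auto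
  show "\<forall>e\<in>E. satisfies ?M e"
    unfolding satisfies_def
  proof (intro ballI allI impI)
    fix e and w :: "nat \<Rightarrow> ('f, nat) trm"
    assume e: "e \<in> E" and w: "range w \<subseteq> universe ?M"
    have wf: "wf_trm ar (fst e)" "wf_trm ar (snd e)"
      using E e by (auto simp: wf_identities_def)
    have "trm_value A v (w x) \<in> universe A" for x
    proof (rule trm_value_in_universe)
      show "is_algebra ar A" using A by (simp add: in_variety_def)
      show "wf_trm ar (w x)" using w by (intro trm_modelD(1)[of _ ar A v]) auto
    qed (rule v)
    then have "range (\<lambda>x. trm_value A v (w x)) \<subseteq> universe A" by auto
    then have eq: "trm_value A (\<lambda>x. trm_value A v (w x)) (fst e) =
        trm_value A (\<lambda>x. trm_value A v (w x)) (snd e)"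
      using A e by (simp add: in_variety_def satisfies_def)
    note 1 = trm_model_value[OF w wf(1)] and 2 = trm_model_value[OF w wf(2)]
    have "trm_value ?M w (fst e) = trm_rep ar A v (trm_value A v (trm_value ?M w (fst e)))"
      using trm_modelD(2)[of "trm_value ?M w (fst e)" ar A v] 1 by simp
    also have "\<dots> = trm_rep ar A v (trm_value A v (trm_value ?M w (snd e)))"
      using 1 2 eq by simp
    also have "\<dots> = trm_value ?M w (snd e)"
      using trm_modelD(2)[of "trm_value ?M w (snd e)" ar A v] 2 by simp
    finally show "trm_value ?M w (fst e) = trm_value ?M w (snd e)" .
  qed
qed

lemma listrel_iff_nth:
  "(xs, ys) \<in> listrel r \<longleftrightarrow> length xs = length ys \<and> (\<forall>i<length xs. (xs ! i, ys ! i) \<in> r)"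
  by (auto simp: listrel_iff_zip in_set_zip)

lemma prod_congruence_in_congruences:
  assumes alg: "\<And>i. i < length As \<Longrightarrow> is_algebra ar (As ! i)"
    and rs: "\<And>i. i < length As \<Longrightarrow> rs ! i \<in> congruences ar (As ! i)"
  shows "prod_congruence As rs \<in> congruences ar (direct_product As)"
proof -
  let ?U = "universe (direct_product As)" and ?R = "prod_congruence As rs"
  have eq: "equiv (universe (As ! i)) (rs ! i)" if "i < length As" for i
    using rs that by (simp add: congruences_def)
  have "equiv ?U ?R"
  proof (rule equivI)
    show "refl_on ?U ?R"
      using eq by (auto simp: refl_on_def prod_congruence_def direct_product_def equiv_def)
    show "sym ?R"
      using eq by (auto simp: sym_def prod_congruence_def equiv_def)
    show "trans ?R"
      unfolding prod_congruence_def
    proof (rule transI, clarsimp)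
      fix x y z i
      assume "\<forall>i<length As. (x ! i, y ! i) \<in> rs ! i" "\<forall>i<length As. (y ! i, z ! i) \<in> rs ! i"
        and i: "i < length As"
      then show "(x ! i, z ! i) \<in> rs ! i"
        using eq[OF i] by (meson equivE transD)
    qed
  qed (auto simp: prod_congruence_def)
  moreover have "(interp (direct_product As) f xs, interp (direct_product As) f ys) \<in> ?R"
    if f: "ar f = Some (length xs)" and xy: "(xs, ys) \<in> listrel ?R" for f xs ys
  proof -
    have len: "length ys = length xs" using xy by (simp add: listrel_iff_nth)
    have *: "(map (\<lambda>x. x ! i) xs, map (\<lambda>x. x ! i) ys) \<in> listrel (rs ! i)"
      if "i < length As" for i
      using xy that by (auto simp: listrel_iff_nth prod_congruence_def)
    have **: "(interp (As ! i) f (map (\<lambda>x. x ! i) xs), interp (As ! i) f (map (\<lambda>x. x ! i) ys))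
        \<in> rs ! i" if "i < length As" for i
      using rs[OF that] *[OF that] f unfolding congruences_def by simp
    have "(interp (As ! i) f (map (\<lambda>x. x ! i) xs)) \<in> universe (As ! i)"
      "(interp (As ! i) f (map (\<lambda>x. x ! i) ys)) \<in> universe (As ! i)" if "i < length As" for i
      using eq[OF that] **[OF that] by (auto simp: equiv_def)
    then show ?thesis
      using ** by (simp add: prod_congruence_def direct_product_def)
  qed
  ultimately show ?thesis by (auto simp: congruences_def)
qed

lemma congruence_on_product:
  fixes As :: "('f, 'a) ualgebra list"
  assumes E: "wf_identities ar E" and cpp: "congruence_product_property ar E"
    and As: "\<And>i. i < length As \<Longrightarrow> in_variety ar E (As ! i)"
    and \<theta>: "\<theta> \<in> congruences ar (direct_product As)"
    and st: "s \<in> universe (direct_product As)" "t \<in> universe (direct_product As)"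
    and uv: "\<And>j. j < length As \<Longrightarrow> (u j, v j) \<in> \<theta> \<and> u j ! j = s ! j \<and> v j ! j = t ! j"
  shows "(s, t) \<in> \<theta>"
proof -
  define n where "n = length As"
  have eq: "equiv (universe (direct_product As)) \<theta>" using \<theta> by (simp add: congruences_def)
  have uvU: "u j \<in> universe (direct_product As)" "v j \<in> universe (direct_product As)"
    if "j < n" for j
    using uv[of j] that eq by (auto simp: n_def equiv_def)
  define X where "X i = {s ! i, t ! i} \<union> (\<lambda>j. u j ! i) ` {..<n} \<union> (\<lambda>j. v j ! i) ` {..<n}" for i
  define w where "w i = from_nat_into (X i)" for i
  have rw: "range (w i) = X i" for i
    unfolding w_def by (rule range_from_nat_into) (auto simp: X_def intro: countable_finite)
  have XU: "X i \<subseteq> universe (As ! i)" if "i < n" for i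
    using that st uvU by (auto simp: X_def n_def direct_product_def)
  define M where "M i = trm_model ar (As ! i) (w i)" for i
  define Ms where "Ms = map M [0..<n]"
  have [simp]: "length Ms = n" "\<And>i. i < n \<Longrightarrow> Ms ! i = M i" by (auto simp: Ms_def)
  define h where "h x = map (\<lambda>i. trm_value (As ! i) (w i) (x ! i)) [0..<n]" for x
  define g where "g x = map (\<lambda>i. trm_rep ar (As ! i) (w i) (x ! i)) [0..<n]" for x
  have [simp]: "length (h x) = n" "length (g y) = n" for x y by (auto simp: h_def g_def)
  have Xval: "b \<in> trm_value (As ! i) (w i) ` {t. wf_trm ar t}" if "b \<in> X i" for i b
  proof -
    obtain k where "b = w i k" using \<open>b \<in> X i\<close> rw[of i] by auto
    then show ?thesis by (intro image_eqI[of _ _ "Var k"]) auto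
  qed
  have MV: "in_variety ar E (M i)" if "i < n" for i
    unfolding M_def
    by (rule trm_model_in_variety[OF E]) (use As XU[OF that] rw that in \<open>simp_all add: n_def\<close>)
  have g: "g x \<in> universe (direct_product Ms) \<and> h (g x) = x"
    if x: "length x = n" "\<And>i. i < n \<Longrightarrow> x ! i \<in> X i" for x
  proof
    show "g x \<in> universe (direct_product Ms)"
      using Xval x by (auto simp: direct_product_def g_def M_def trm_model_def)
    show "h (g x) = x"
      using trm_rep(2)[OF Xval[OF x(2)]] x(1) by (intro nth_equalityI) (simp_all add: g_def h_def)
  qed
  have h: "h x \<in> universe (direct_product As)" if "x \<in> universe (direct_product Ms)" for x
  proof -
    have "trm_value (As ! i) (w i) (x ! i) \<in> universe (As ! i)" if i: "i < n" for i
    proof (rule trm_value_in_universe)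
      show "is_algebra ar (As ! i)" using As i by (simp add: n_def in_variety_def)
      show "range (w i) \<subseteq> universe (As ! i)" using rw XU i by simp
      show "wf_trm ar (x ! i)"
        using \<open>x \<in> universe (direct_product Ms)\<close> i trm_modelD(1)[of "x ! i" ar "As ! i" "w i"]
        by (auto simp: direct_product_def M_def)
    qed
    then show ?thesis by (auto simp: direct_product_def h_def n_def)
  qed
  define \<theta>' where "\<theta>' = {(x, y). x \<in> universe (direct_product Ms) \<and>
    y \<in> universe (direct_product Ms) \<and> (h x, h y) \<in> \<theta>}"
  have "equiv (universe (direct_product Ms)) \<theta>'"
  proof (rule equivI)
    show "refl_on (universe (direct_product Ms)) \<theta>'"
      using eq h by (auto simp: refl_on_def \<theta>'_def equiv_def)
    show "sym \<theta>'"
      using eq by (auto simp: sym_def \<theta>'_def equiv_def)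
    show "trans \<theta>'"
      using eq unfolding \<theta>'_def equiv_def trans_def by blast
  qed (auto simp: \<theta>'_def)
  moreover have "(interp (direct_product Ms) f xs, interp (direct_product Ms) f ys) \<in> \<theta>'"
    if f: "ar f = Some (length xs)" and xy: "(xs, ys) \<in> listrel \<theta>'" for f xs ys
  proof -
    have len: "length ys = length xs" using xy by (simp add: listrel_iff_nth)
    have 1: "interp (direct_product Ms) f zs \<in> universe (direct_product Ms) \<and>
        h (interp (direct_product Ms) f zs) = interp (direct_product As) f (map h zs)"
      if zs: "set zs \<subseteq> universe (direct_product Ms)" and l: "length zs = length xs" for zs
    proof -
      have 0: "set (map (\<lambda>x. x ! i) zs) \<subseteq> universe (M i)" if "i < n" for i
        using zs that by (auto simp: direct_product_def)
      have a: "ar f = Some (length (map (\<lambda>x. x ! i) zs))" for i using f l by simp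
      have 2: "interp (M i) f (map (\<lambda>x. x ! i) zs) \<in> universe (M i)"
        "trm_value (As ! i) (w i) (interp (M i) f (map (\<lambda>x. x ! i) zs)) =
         interp (As ! i) f (map (trm_value (As ! i) (w i)) (map (\<lambda>x. x ! i) zs))" if "i < n" for i
        using trm_model_interp[of ar f "map (\<lambda>x. x ! i) zs" "As ! i" "w i"] a[of i] 0[OF that]
        by (simp_all add: M_def)
      have 3: "map (trm_value (As ! i) (w i)) (map (\<lambda>x. x ! i) zs) =
          map (\<lambda>x. x ! i) (map h zs)" if "i < n" for i
        using that by (simp add: h_def)
      have "interp (direct_product Ms) f zs \<in> universe (direct_product Ms)"
        using 2(1) by (auto simp: direct_product_def)
      moreover have "h (interp (direct_product Ms) f zs) = interp (direct_product As) f (map h zs)"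
      proof (rule nth_equalityI)
        fix i assume "i < length (h (interp (direct_product Ms) f zs))"
        then have i: "i < n" by simp
        have "h (interp (direct_product Ms) f zs) ! i =
            trm_value (As ! i) (w i) (interp (M i) f (map (\<lambda>x. x ! i) zs))"
          using i by (simp add: h_def direct_product_def)
        also have "\<dots> = interp (As ! i) f (map (\<lambda>x. x ! i) (map h zs))"
          using 2(2)[OF i] 3[OF i] by (simp del: map_map)
        also have "\<dots> = interp (direct_product As) f (map h zs) ! i"
          using i by (simp add: direct_product_def n_def)
        finally show "h (interp (direct_product Ms) f zs) ! i =
            interp (direct_product As) f (map h zs) ! i" .
      qed (simp add: direct_product_def n_def)
      ultimately show ?thesis by simp
    qed
    have sets: "set xs \<subseteq> universe (direct_product Ms)" "set ys \<subseteq> universe (direct_product Ms)"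
      using xy len by (auto simp: listrel_iff_nth \<theta>'_def in_set_conv_nth)
    have "(map h xs, map h ys) \<in> listrel \<theta>"
      using xy by (auto simp: listrel_iff_nth \<theta>'_def)
    then have "(interp (direct_product As) f (map h xs), interp (direct_product As) f (map h ys)) \<in> \<theta>"
      using \<theta> f unfolding congruences_def by simp
    then show ?thesis
      using 1[OF sets(1)] 1[OF sets(2)] len by (simp add: \<theta>'_def)
  qed
  ultimately have "\<theta>' \<in> congruences ar (direct_product Ms)" by (auto simp: congruences_def)
  moreover have "congruences_factor ar Ms"
    using cpp MV unfolding congruence_product_property_def by (auto simp: Ms_def)
  ultimately obtain rs where rs: "\<theta>' = prod_congruence Ms rs"
    unfolding congruences_factor_def by blast
  have len: "length x = n" if "x \<in> universe (direct_product As)" for x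
    using that by (simp add: direct_product_def n_def)
  have gs: "g s \<in> universe (direct_product Ms) \<and> h (g s) = s"
    and gt: "g t \<in> universe (direct_product Ms) \<and> h (g t) = t"
    by (rule g; use len st in \<open>simp add: X_def\<close>)+
  have "(g s ! j, g t ! j) \<in> rs ! j" if j: "j < n" for j
  proof -
    have "g (u j) \<in> universe (direct_product Ms) \<and> h (g (u j)) = u j"
      "g (v j) \<in> universe (direct_product Ms) \<and> h (g (v j)) = v j"
      by (rule g; use len uvU j in \<open>auto simp: X_def\<close>)+
    then have "(g (u j), g (v j)) \<in> \<theta>'" using uv j by (simp add: \<theta>'_def n_def)
    then have "(g (u j) ! j, g (v j) ! j) \<in> rs ! j" using j by (simp add: rs prod_congruence_def)
    moreover have "g (u j) ! j = g s ! j" "g (v j) ! j = g t ! j"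
      using uv j by (auto simp: g_def n_def)
    ultimately show ?thesis by simp
  qed
  then have "(g s, g t) \<in> \<theta>'" using gs gt by (simp add: rs prod_congruence_def)
  then show ?thesis using gs gt by (simp add: \<theta>'_def)
qed

lemma congruence_product_propertyD:
  fixes As :: "('f, 'a) ualgebra list"
  assumes E: "wf_identities ar E" and cpp: "congruence_product_property ar E"
    and As: "\<forall>A\<in>set As. in_variety ar E A"
  shows "congruences_factor ar As"
proof -
  let ?U = "universe (direct_product As)"
  have As': "in_variety ar E (As ! i)" if "i < length As" for i using As that by auto
  then have alg: "is_algebra ar (As ! i)" if "i < length As" for i
    using that by (simp add: in_variety_def)
  have "\<exists>rs. \<theta> = prod_congruence As rs \<and> length rs = length As \<and>
      (\<forall>i<length As. rs ! i \<in> congruences ar (As ! i))"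
    if \<theta>: "\<theta> \<in> congruences ar (direct_product As)" for \<theta>
  proof (cases "?U = {}")
    case True
    let ?rs = "map (\<lambda>A. Id_on (universe A)) As"
    have "Id_on (universe A) \<in> congruences ar A" if A: "is_algebra ar A" for A :: "('f, 'a) ualgebra"
    proof -
      have Id: "xs = ys \<and> set xs \<subseteq> universe A" if "(xs, ys) \<in> listrel (Id_on (universe A))" for xs ys
      proof -
        have l: "length xs = length ys" and
          n: "\<And>i. i < length xs \<Longrightarrow> xs ! i = ys ! i \<and> xs ! i \<in> universe A"
          using that by (auto simp: listrel_iff_nth Id_on_iff)
        have "xs = ys" using l n by (intro nth_equalityI) auto
        moreover have "set xs \<subseteq> universe A" using n by (metis in_set_conv_nth subsetI)
        ultimately show ?thesis by simp
      qed
      have "(interp A f xs, interp A f ys) \<in> Id_on (universe A)"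
        if "ar f = Some (length xs)" "(xs, ys) \<in> listrel (Id_on (universe A))" for f xs ys
      proof -
        have "interp A f xs \<in> universe A"
          using A that(1) Id[OF that(2)] unfolding is_algebra_def by metis
        then show ?thesis using Id[OF that(2)] by (simp add: Id_on_iff)
      qed
      moreover have "equiv (universe A) (Id_on (universe A))"
        by (auto simp: equiv_def refl_on_def sym_def trans_def)
      ultimately show ?thesis by (simp add: congruences_def)
    qed
    moreover have "\<theta> = prod_congruence As ?rs"
      using True \<theta> by (auto simp: congruences_def equiv_def prod_congruence_def)
    ultimately show ?thesis using alg by (intro exI[of _ ?rs]) auto
  next
    case False
    have eq: "equiv ?U \<theta>" using \<theta> by (simp add: congruences_def)
    have \<theta>U: "x \<in> ?U" "y \<in> ?U" if "(x, y) \<in> \<theta>" for x y using eq that by (auto simp: equiv_def)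
    have refl: "(x, x) \<in> \<theta>" if "x \<in> ?U" for x using eq that by (auto simp: equiv_def refl_on_def)
    obtain z where z: "z \<in> ?U" using False by blast
    define R where "R i = {(x ! i, y ! i) |x y. (x, y) \<in> \<theta>}" for i
    have upd: "z[i := a] \<in> ?U" "z[i := a] ! i = a" if "i < length As" "a \<in> universe (As ! i)" for i a
      using z that by (auto simp: direct_product_def nth_list_update)
    have RD: "(s, t) \<in> \<theta>"
      if "s \<in> ?U" "t \<in> ?U" and R: "\<And>j. j < length As \<Longrightarrow> (s ! j, t ! j) \<in> R j" for s t
    proof -
      have "\<forall>j. \<exists>u v. j < length As \<longrightarrow> (u, v) \<in> \<theta> \<and> u ! j = s ! j \<and> v ! j = t ! j"
      proof
        fix j
        show "\<exists>u v. j < length As \<longrightarrow> (u, v) \<in> \<theta> \<and> u ! j = s ! j \<and> v ! j = t ! j"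
        proof (cases "j < length As")
          case True
          from R[OF this] obtain x y where "s ! j = x ! j" "t ! j = y ! j" "(x, y) \<in> \<theta>"
            unfolding R_def by blast
          then show ?thesis by (intro exI[of _ x] exI[of _ y]) simp
        qed simp
      qed
      then obtain u v where
        "\<And>j. j < length As \<Longrightarrow> (u j, v j) \<in> \<theta> \<and> u j ! j = s ! j \<and> v j ! j = t ! j"
        by metis
      then show ?thesis
        by (intro congruence_on_product[OF E cpp As' \<theta> \<open>s \<in> ?U\<close> \<open>t \<in> ?U\<close>])
    qed
    have RU: "a \<in> universe (As ! i)" "b \<in> universe (As ! i)"
      if "i < length As" "(a, b) \<in> R i" for i a b
      using that \<theta>U by (auto simp: R_def direct_product_def)
    have R\<theta>: "(z[i := a], z[i := b]) \<in> \<theta>" if i: "i < length As" and ab: "(a, b) \<in> R i" for i a b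
    proof (rule RD)
      show "z[i := a] \<in> ?U" "z[i := b] \<in> ?U" using upd(1) i RU[OF i ab] by auto
      fix j assume j: "j < length As"
      have "(z ! j, z ! j) \<in> R j" using refl[OF z] by (auto simp: R_def)
      then show "(z[i := a] ! j, z[i := b] ! j) \<in> R j"
        using upd(2) i RU[OF i ab] ab by (cases "i = j") auto
    qed
    have \<theta>R: "(a, b) \<in> R i"
      if "i < length As" "a \<in> universe (As ! i)" "b \<in> universe (As ! i)"
        "(z[i := a], z[i := b]) \<in> \<theta>" for i a b
      proof -
      have "(z[i := a] ! i, z[i := b] ! i) \<in> R i"
        unfolding R_def using that(4) by blast
      then show ?thesis using upd(2) that(1-3) by simp
    qed
    have "R i \<in> congruences ar (As ! i)" if i: "i < length As" for i
    proof -
      have "equiv (universe (As ! i)) (R i)"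
      proof (rule equivI)
        show "R i \<subseteq> universe (As ! i) \<times> universe (As ! i)" using RU[OF i] by auto
        show "refl_on (universe (As ! i)) (R i)"
          using \<theta>R[OF i] refl upd(1)[OF i] by (auto simp: refl_on_def)
        show "sym (R i)"
          using eq unfolding sym_def R_def equiv_def by blast
        show "trans (R i)"
        proof (rule transI)
          fix a b c assume ab: "(a, b) \<in> R i" and bc: "(b, c) \<in> R i"
          then have "(z[i := a], z[i := c]) \<in> \<theta>"
            using R\<theta>[OF i] eq by (meson equivE transD)
          then show "(a, c) \<in> R i" using \<theta>R[OF i] RU[OF i ab] RU[OF i bc] by blast
        qed
      qed
      moreover have "(interp (As ! i) f xs, interp (As ! i) f ys) \<in> R i"
        if f: "ar f = Some (length xs)" and xy: "(xs, ys) \<in> listrel (R i)" for f xs ys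
      proof -
        let ?xs = "map (\<lambda>a. z[i := a]) xs" and ?ys = "map (\<lambda>a. z[i := a]) ys"
        have "(?xs, ?ys) \<in> listrel \<theta>"
          using xy R\<theta>[OF i] by (auto simp: listrel_iff_nth)
        then have "(interp (direct_product As) f ?xs, interp (direct_product As) f ?ys) \<in> \<theta>"
          using \<theta> f unfolding congruences_def by simp
        then have "(interp (direct_product As) f ?xs ! i, interp (direct_product As) f ?ys ! i) \<in> R i"
          unfolding R_def by blast
        moreover have "i < length z" using z i by (simp add: direct_product_def)
        ultimately show ?thesis using i by (simp add: direct_product_def o_def)
      qed
      ultimately show ?thesis by (auto simp: congruences_def)
    qed
    moreover have "\<theta> = prod_congruence As (map R [0..<length As])"
    proof (intro subset_antisym subrelI)
      fix s t assume st: "(s, t) \<in> \<theta>"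
      then have "(s ! i, t ! i) \<in> R i" for i unfolding R_def by blast
      then show "(s, t) \<in> prod_congruence As (map R [0..<length As])"
        using \<theta>U[OF st] by (simp add: prod_congruence_def)
    next
      fix s t assume "(s, t) \<in> prod_congruence As (map R [0..<length As])"
      then show "(s, t) \<in> \<theta>" by (intro RD) (auto simp: prod_congruence_def)
    qed
    ultimately show ?thesis by (intro exI[of _ "map R [0..<length As]"]) auto
  qed
  then show ?thesis
    unfolding congruences_factor_def using prod_congruence_in_congruences[OF alg] by blast
qed


section \<open>Full shifts, subshifts and cellular automata\<close>

definition shift_algebra :: "('f, 'a) ualgebra \<Rightarrow> ('f, int \<Rightarrow> 'a) ualgebra" where
  "shift_algebra A =
     \<lparr>universe = {x. \<forall>i. x i \<in> universe A}, interp = (\<lambda>f xs i. interp A f (map (\<lambda>x. x i) xs))\<rparr>"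

abbreviation full_shift :: "('f, 'a) ualgebra \<Rightarrow> (int \<Rightarrow> 'a) set" where
  "full_shift A \<equiv> universe (shift_algebra A)"

definition shift_topology :: "('f, 'a) ualgebra \<Rightarrow> (int \<Rightarrow> 'a) topology" where
  "shift_topology A = product_topology (\<lambda>_. discrete_topology (universe A)) UNIV"

lemma topspace_shift_topology: "topspace (shift_topology A) = full_shift A"
  by (auto simp: shift_topology_def shift_algebra_def)

definition shift :: "(int \<Rightarrow> 'a) \<Rightarrow> int \<Rightarrow> 'a" where
  "shift x = (\<lambda>i. x (i + 1))"

definition shift_power :: "int \<Rightarrow> (int \<Rightarrow> 'a) \<Rightarrow> int \<Rightarrow> 'a" where
  "shift_power k x = (\<lambda>i. x (i + k))"

lemma shift_power_of_nat: "shift_power (int n) = shift ^^ n"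
proof (induction n)
  case (Suc n)
  have "shift_power (int (Suc n)) x = shift (shift_power (int n) x)" for x :: "int \<Rightarrow> 'a"
    by (auto simp: shift_power_def shift_def algebra_simps)
  then show ?case using Suc by auto
qed (auto simp: shift_power_def)

lemma shift_power_uminus: "shift_power (- k) (shift_power k x) = x"
  by (simp add: shift_power_def)

definition subshift :: "('f, 'a) ualgebra \<Rightarrow> (int \<Rightarrow> 'a) set \<Rightarrow> bool" where
  "subshift A X \<longleftrightarrow> closedin (shift_topology A) X \<and> shift ` X = X"

definition cellular_automaton :: "('f, 'a) ualgebra \<Rightarrow> ((int \<Rightarrow> 'a) \<Rightarrow> int \<Rightarrow> 'a) \<Rightarrow> bool" where
  "cellular_automaton A G \<longleftrightarrow>
     continuous_map (shift_topology A) (shift_topology A) G \<and>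
     (\<forall>x\<in>full_shift A. G (shift x) = shift (G x))"

definition linear_cellular_automaton ::
    "'f signature \<Rightarrow> ('f, 'a) ualgebra \<Rightarrow> ((int \<Rightarrow> 'a) \<Rightarrow> int \<Rightarrow> 'a) \<Rightarrow> bool" where
  "linear_cellular_automaton ar A G \<longleftrightarrow>
     cellular_automaton A G \<and> morphism ar (shift_algebra A) (shift_algebra A) G"

definition limit_set :: "('f, 'a) ualgebra \<Rightarrow> ((int \<Rightarrow> 'a) \<Rightarrow> int \<Rightarrow> 'a) \<Rightarrow> (int \<Rightarrow> 'a) set" where
  "limit_set A G = (\<Inter>n. (G ^^ n) ` full_shift A)"

definition stable_ca :: "('f, 'a) ualgebra \<Rightarrow> ((int \<Rightarrow> 'a) \<Rightarrow> int \<Rightarrow> 'a) \<Rightarrow> bool" where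
  "stable_ca A G \<longleftrightarrow> (\<exists>n. limit_set A G = (G ^^ n) ` full_shift A)"

definition conjugacy ::
    "('f, 'a) ualgebra \<Rightarrow> (int \<Rightarrow> 'a) set \<Rightarrow> ('f, 'b) ualgebra \<Rightarrow> (int \<Rightarrow> 'b) set \<Rightarrow>
     ((int \<Rightarrow> 'a) \<Rightarrow> int \<Rightarrow> 'b) \<Rightarrow> bool" where
  "conjugacy A X B Y \<phi> \<longleftrightarrow>
     subshift A X \<and> subshift B Y \<and> bij_betw \<phi> X Y \<and>
     continuous_map (subtopology (shift_topology A) X) (subtopology (shift_topology B) Y) \<phi> \<and>
     (\<forall>x\<in>X. \<phi> (shift x) = shift (\<phi> x))"

definition algebraic_conjugacy ::
    "'f signature \<Rightarrow> ('f, 'a) ualgebra \<Rightarrow> (int \<Rightarrow> 'a) set \<Rightarrow> ('f, 'b) ualgebra \<Rightarrow> (int \<Rightarrow> 'b) set \<Rightarrow>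
     ((int \<Rightarrow> 'a) \<Rightarrow> int \<Rightarrow> 'b) \<Rightarrow> bool" where
  "algebraic_conjugacy ar A X B Y \<phi> \<longleftrightarrow>
     conjugacy A X B Y \<phi> \<and>
     subalgebra ar (shift_algebra A) X \<and> subalgebra ar (shift_algebra B) Y \<and>
     morphism ar (shift_algebra A\<lparr>universe := X\<rparr>) (shift_algebra B\<lparr>universe := Y\<rparr>) \<phi>"

text \<open>
  On a product of full shifts, seen as a full shift over lists, \<open>prod_shift_powers ks\<close> applies
  the \<open>(ks ! j)\<close>-th power of the shift map to the \<open>j\<close>-th component.
\<close>

definition prod_shift_powers :: "int list \<Rightarrow> (int \<Rightarrow> 'a list) \<Rightarrow> int \<Rightarrow> 'a list" where
  "prod_shift_powers ks y =
     (\<lambda>i. map (\<lambda>j. shift_power (ks ! j) (\<lambda>i. y i ! j) i) [0..<length ks])"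

end

theory Submission
  imports Defs
begin

text \<open>
  The map \<open>G\<close> sends constant configurations to constant configurations and so induces
  a map \<open>b\<close> on the finite set of letters.  Some power \<open>b ^^ N\<close> with \<open>N \<ge> 1\<close> is
  idempotent; put \<open>F = G ^^ N\<close> and \<open>e = b ^^ N\<close>, so that \<open>F\<close> maps the
  constant configuration \<open>a\<close> to the constant configuration \<open>e a\<close>, and let
  \<open>\<theta>\<close> be the kernel of \<open>e\<close>.

  For a congruence \<open>\<kappa>\<close> on the letters, the relation \<open>(F x 0, F y 0) \<in> \<kappa>\<close> is a congruence on
  the words over the finite window that \<open>F\<close> looks at.  By the congruence-product property it
  holds iff \<open>x\<close> and \<open>y\<close> are related, at each cell \<open>k\<close> of the window, by a congruence
  on letters that depends on \<open>k\<close> only (\<open>congruence_through_window\<close>).  This is used twice.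
  With equality for \<open>\<kappa>\<close>, a comparison of constant configurations shows that the congruences
  obtained meet in \<open>\<theta>\<close>, hence \<open>F x = F y\<close> iff \<open>x\<close> and \<open>y\<close> are cellwise
  \<open>\<theta>\<close>-related.  With \<open>\<theta>\<close> for \<open>\<kappa>\<close>, call them \<open>d\<^sub>k\<close>; they too meet in
  \<open>\<theta>\<close>, because \<open>e\<close> is idempotent.

  The decisive remark is that the letter \<open>c = F x 0\<close> satisfies \<open>(e c, c) \<in> \<theta>\<close>: the images
  under \<open>F\<close> of the constant configuration \<open>c\<close> and of \<open>x\<close> are \<open>\<theta>\<close>-related at
  \<open>0\<close>, and therefore \<open>(c, x k) \<in> d\<^sub>k\<close> for all \<open>k\<close>.  In other words, modulo
  \<open>d\<^sub>k\<close> the map \<open>F\<close> is the \<open>k\<close>-th power of the shift.  As the letters \<open>x k\<close> are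
  arbitrary, it also follows that the map from the letters to the product of the quotients by the
  \<open>d\<^sub>k\<close> is onto; its kernel is \<open>\<theta>\<close>
  (\<open>coordinates_of_idempotent_on_constants\<close>).

  So \<open>F\<close> has the same kernel as the cellwise map onto the full shift over that product, which
  makes its image conjugate to this full shift (\<open>algebraic_conjugacy_of_kernel\<close>), with
  \<open>F\<close> acting on it as a product of powers of shifts.  In particular \<open>F\<close> maps its image
  onto itself, so the image is the limit set of \<open>G\<close>, and the exponent is \<open>p = N\<close>.
\<close>

section \<open>Morphisms, congruences and quotients\<close>

lemma morphism_comp:
  assumes "morphism ar A B g" "morphism ar B C h"
  shows "morphism ar A C (h \<circ> g)"
  unfolding morphism_def
proof (intro conjI allI impI)
  show "(h \<circ> g) ` universe A \<subseteq> universe C"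
    using assms by (simp add: morphism_def image_subset_iff)
  fix f n xs assume *: "ar f = Some n \<and> length xs = n \<and> set xs \<subseteq> universe A"
  then have "set (map g xs) \<subseteq> universe B" using assms by (auto simp: morphism_def image_subset_iff)
  then have "h (interp B f (map g xs)) = interp C f (map h (map g xs))"
    using * assms(2) unfolding morphism_def by (metis length_map)
  then show "(h \<circ> g) (interp A f xs) = interp C f (map (h \<circ> g) xs)"
    using * assms(1) by (auto simp: morphism_def)
qed

lemma trm_value_morphism:
  assumes A: "is_algebra ar A" and h: "morphism ar A B h"
    and v: "range v \<subseteq> universe A" and "wf_trm ar t"
  shows "h (trm_value A v t) = trm_value B (h \<circ> v) t"
  using assms(4)
proof (induction t)
  case (App f ts)
  have "set (map (trm_value A v) ts) \<subseteq> universe A"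
    using App.prems trm_value_in_universe[OF A v] by auto
  moreover have "ar f = Some (length (map (trm_value A v) ts))" using App.prems by simp
  ultimately have "h (interp A f (map (trm_value A v) ts)) =
      interp B f (map h (map (trm_value A v) ts))"
    using h unfolding morphism_def by blast
  also have "map h (map (trm_value A v) ts) = map (trm_value B (h \<circ> v)) ts"
    using App by (auto simp: comp_def)
  finally show ?case by (simp add: comp_def)
qed simp

lemma in_variety_surjective_image:
  assumes E: "wf_identities ar E" and A: "in_variety ar E A"
    and h: "morphism ar A B h" and surj: "h ` universe A = universe B"
  shows "in_variety ar E B"
proof -
  have algA: "is_algebra ar A" using A by (simp add: in_variety_def)
  define s where "s = inv_into (universe A) h"
  have s: "s b \<in> universe A" "h (s b) = b" if "b \<in> universe B" for b
    using that surj by (auto simp: s_def inv_into_into f_inv_into_f)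
  have "interp B f xs \<in> universe B" if f: "ar f = Some (length xs)" "set xs \<subseteq> universe B" for f xs
  proof -
    have *: "set (map s xs) \<subseteq> universe A" using s f by auto
    then have "interp A f (map s xs) \<in> universe A"
      using algA f unfolding is_algebra_def by (metis length_map)
    moreover have "h (interp A f (map s xs)) = interp B f (map h (map s xs))"
      using h * f unfolding morphism_def by (metis length_map)
    moreover have "map h (map s xs) = xs" using s f(2) by (auto intro!: map_idI)
    ultimately show ?thesis using surj by (metis image_eqI)
  qed
  moreover have "satisfies B e" if e: "e \<in> E" for e
    unfolding satisfies_def
  proof (intro allI impI)
    fix v :: "nat \<Rightarrow> _" assume v: "range v \<subseteq> universe B"
    have sv: "range (s \<circ> v) \<subseteq> universe A" and hsv: "h \<circ> (s \<circ> v) = v"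
      using v s by (auto simp: fun_eq_iff)
    have "wf_trm ar (fst e)" "wf_trm ar (snd e)" using E e by (auto simp: wf_identities_def)
    then show "trm_value B v (fst e) = trm_value B v (snd e)"
      using trm_value_morphism[OF algA h sv] A e sv
      unfolding in_variety_def satisfies_def hsv by metis
  qed
  ultimately show ?thesis by (simp add: in_variety_def is_algebra_def)
qed

text \<open>With equality in place of \<open>\<kappa>\<close>, the pullback is the kernel of \<open>h\<close>.\<close>

definition pullback :: "('f, 'a) ualgebra \<Rightarrow> ('a \<Rightarrow> 'b) \<Rightarrow> ('b \<times> 'b) set \<Rightarrow> ('a \<times> 'a) set" where
  "pullback A h \<kappa> = {(x, y). x \<in> universe A \<and> y \<in> universe A \<and> (h x, h y) \<in> \<kappa>}"

lemma pullback_congruence: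
  assumes A: "is_algebra ar A" and h: "morphism ar A B h" and \<kappa>: "\<kappa> \<in> congruences ar B"
  shows "pullback A h \<kappa> \<in> congruences ar A"
proof -
  have eq: "equiv (universe B) \<kappa>" using \<kappa> by (simp add: congruences_def)
  have hU: "h x \<in> universe B" if "x \<in> universe A" for x
    using h that by (auto simp: morphism_def)
  have "equiv (universe A) (pullback A h \<kappa>)"
  proof (rule equivI)
    show "refl_on (universe A) (pullback A h \<kappa>)"
      using eq hU by (auto simp: refl_on_def pullback_def equiv_def)
    show "sym (pullback A h \<kappa>)"
      using eq by (auto simp: sym_def pullback_def equiv_def)
    show "trans (pullback A h \<kappa>)"
      using eq unfolding trans_def pullback_def equiv_def by blast
  qed (auto simp: pullback_def)
  moreover have "(interp A f xs, interp A f ys) \<in> pullback A h \<kappa>"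
    if f: "ar f = Some (length xs)" and xy: "(xs, ys) \<in> listrel (pullback A h \<kappa>)" for f xs ys
  proof -
    have len: "length ys = length xs" and
      nth: "\<And>i. i < length xs \<Longrightarrow> (xs ! i, ys ! i) \<in> pullback A h \<kappa>"
      using xy by (auto simp: listrel_iff_nth)
    have sub: "set xs \<subseteq> universe A" "set ys \<subseteq> universe A"
      using nth len by (auto simp: in_set_conv_nth pullback_def)
    have "(map h xs, map h ys) \<in> listrel \<kappa>"
      using nth len by (auto simp: listrel_iff_nth pullback_def)
    then have "(interp B f (map h xs), interp B f (map h ys)) \<in> \<kappa>"
      using \<kappa> f unfolding congruences_def by simp
    moreover have "h (interp A f xs) = interp B f (map h xs)"
      "h (interp A f ys) = interp B f (map h ys)"
      using h f len sub unfolding morphism_def by metis+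
    moreover have "interp A f xs \<in> universe A" "interp A f ys \<in> universe A"
      using A f len sub unfolding is_algebra_def by metis+
    ultimately show ?thesis by (simp add: pullback_def)
  qed
  ultimately show ?thesis by (auto simp: congruences_def)
qed

lemma Id_on_congruence:
  assumes A: "is_algebra ar A"
  shows "Id_on (universe A) \<in> congruences ar A"
proof -
  have "equiv (universe A) (Id_on (universe A))"
    by (auto simp: equiv_def refl_on_def sym_def trans_def)
  moreover have "(interp A f xs, interp A f ys) \<in> Id_on (universe A)"
    if f: "ar f = Some (length xs)" and xy: "(xs, ys) \<in> listrel (Id_on (universe A))" for f xs ys
  proof -
    have l: "length xs = length ys" and
      n: "\<And>i. i < length xs \<Longrightarrow> xs ! i = ys ! i \<and> xs ! i \<in> universe A"
      using xy by (auto simp: listrel_iff_nth Id_on_iff)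
    have "xs = ys" using l n by (intro nth_equalityI) auto
    moreover have "set xs \<subseteq> universe A" using n by (metis in_set_conv_nth subsetI)
    ultimately show ?thesis using A f unfolding is_algebra_def by (simp add: Id_on_iff)
  qed
  ultimately show ?thesis by (simp add: congruences_def)
qed

text \<open>The classes of a congruence on a finite algebra are numbered, so that the quotient becomes
  an algebra on natural numbers, whatever the carrier type was.\<close>

definition class_index :: "('f, 'a) ualgebra \<Rightarrow> ('a \<times> 'a) set \<Rightarrow> 'a \<Rightarrow> nat" where
  "class_index A \<rho> a = to_nat_on (universe A // \<rho>) (\<rho> `` {a})"

definition quotient_algebra :: "('f, 'a) ualgebra \<Rightarrow> ('a \<times> 'a) set \<Rightarrow> ('f, nat) ualgebra" where
  "quotient_algebra A \<rho> =
     \<lparr>universe = class_index A \<rho> ` universe A,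
      interp = (\<lambda>f cs. class_index A \<rho>
        (interp A f (map (inv_into (universe A) (class_index A \<rho>)) cs)))\<rparr>"

lemma class_index_eq_iff:
  assumes fin: "finite (universe A)" and eq: "equiv (universe A) \<rho>"
    and a: "a \<in> universe A" and b: "b \<in> universe A"
  shows "class_index A \<rho> a = class_index A \<rho> b \<longleftrightarrow> (a, b) \<in> \<rho>"
proof -
  have "countable (universe A // \<rho>)"
    using fin by (intro countable_finite) (simp add: quotient_def)
  then have "class_index A \<rho> a = class_index A \<rho> b \<longleftrightarrow> \<rho> `` {a} = \<rho> `` {b}"
    unfolding class_index_def using a b by (intro to_nat_on_inj) (auto intro: quotientI)
  then show ?thesis using eq_equiv_class_iff[OF eq a b] by simp
qed

text \<open>The operations of the quotient are computed on representatives picked by \<open>inv_into\<close>;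
  compatibility of \<open>\<rho>\<close> with the operations makes the choice immaterial.\<close>

lemma class_index_morphism:
  assumes A: "is_algebra ar A" and fin: "finite (universe A)" and \<rho>: "\<rho> \<in> congruences ar A"
  shows "morphism ar A (quotient_algebra A \<rho>) (class_index A \<rho>)"
proof -
  let ?q = "class_index A \<rho>" and ?s = "inv_into (universe A) (class_index A \<rho>)"
  have eq: "equiv (universe A) \<rho>" using \<rho> by (simp add: congruences_def)
  note q = class_index_eq_iff[OF fin eq]
  have s: "?s (?q a) \<in> universe A" "(a, ?s (?q a)) \<in> \<rho>" if a: "a \<in> universe A" for a
  proof -
    show "?s (?q a) \<in> universe A" using a by (simp add: inv_into_into)
    then show "(a, ?s (?q a)) \<in> \<rho>"
      using q[OF a, of "?s (?q a)"] a by (simp add: f_inv_into_f)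
  qed
  have "?q (interp A f xs) = ?q (interp A f (map ?s (map ?q xs)))"
    if f: "ar f = Some (length xs)" and xs: "set xs \<subseteq> universe A" for f xs
  proof -
    have "(xs, map ?s (map ?q xs)) \<in> listrel \<rho>"
      using s xs by (simp add: listrel_iff_nth subset_iff)
    then have "(interp A f xs, interp A f (map ?s (map ?q xs))) \<in> \<rho>"
      using \<rho> f unfolding congruences_def by blast
    moreover have "set (map ?s (map ?q xs)) \<subseteq> universe A" using s xs by auto
    then have "interp A f (map ?s (map ?q xs)) \<in> universe A" "interp A f xs \<in> universe A"
      using A f xs unfolding is_algebra_def by (metis length_map)+
    ultimately show ?thesis using q by blast
  qed
  then show ?thesis by (auto simp: morphism_def quotient_algebra_def)
qed

lemma direct_product_algebra:
  assumes "\<And>A. A \<in> set As \<Longrightarrow> is_algebra ar A"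
  shows "is_algebra ar (direct_product As)"
  unfolding is_algebra_def
proof (intro allI impI)
  fix f n xs
  assume *: "ar f = Some n \<and> length xs = n \<and> set xs \<subseteq> universe (direct_product As)"
  have "interp (As ! i) f (map (\<lambda>x. x ! i) xs) \<in> universe (As ! i)" if i: "i < length As" for i
  proof -
    have "set (map (\<lambda>x. x ! i) xs) \<subseteq> universe (As ! i)"
      using * i by (auto simp: direct_product_def)
    then show ?thesis using assms[of "As ! i"] * i unfolding is_algebra_def
      by (metis length_map nth_mem)
  qed
  then show "interp (direct_product As) f xs \<in> universe (direct_product As)"
    by (simp add: direct_product_def)
qed

definition class_indices :: "('f, 'a) ualgebra \<Rightarrow> ('a \<times> 'a) set list \<Rightarrow> 'a \<Rightarrow> nat list" where
  "class_indices A ds a = map (\<lambda>d. class_index A d a) ds"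

lemma class_index_nth_eq_iff:
  assumes "finite (universe A)" "set ds \<subseteq> congruences ar A" "j < length ds"
    "a \<in> universe A" "c \<in> universe A"
  shows "class_index A (ds ! j) a = class_index A (ds ! j) c \<longleftrightarrow> (a, c) \<in> ds ! j"
proof -
  have "ds ! j \<in> congruences ar A" using assms(2,3) nth_mem by blast
  then show ?thesis using assms by (intro class_index_eq_iff) (auto simp: congruences_def)
qed

lemma class_indices_eq_iff:
  assumes "finite (universe A)" "set ds \<subseteq> congruences ar A" "a \<in> universe A" "c \<in> universe A"
  shows "class_indices A ds a = class_indices A ds c \<longleftrightarrow> (\<forall>j<length ds. (a, c) \<in> ds ! j)"
  using class_index_nth_eq_iff[OF assms(1,2) _ assms(3,4)]
  by (simp add: class_indices_def list_eq_iff_nth_eq)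

lemma class_indices_morphism:
  assumes A: "is_algebra ar A" and fin: "finite (universe A)" and ds: "set ds \<subseteq> congruences ar A"
  shows "morphism ar A (direct_product (map (quotient_algebra A) ds)) (class_indices A ds)"
  unfolding morphism_def
proof (intro conjI allI impI)
  show "class_indices A ds ` universe A \<subseteq> universe (direct_product (map (quotient_algebra A) ds))"
    by (auto simp: class_indices_def direct_product_def quotient_algebra_def)
  fix f n xs assume *: "ar f = Some n \<and> length xs = n \<and> set xs \<subseteq> universe A"
  have "class_index A (ds ! j) (interp A f xs) =
      interp (quotient_algebra A (ds ! j)) f (map (class_index A (ds ! j)) xs)"
    if "j < length ds" for j
  proof -
    have "ds ! j \<in> congruences ar A" using ds that nth_mem by blast
    from class_index_morphism[OF A fin this] show ?thesis using * unfolding morphism_def by blast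
  qed
  then show "class_indices A ds (interp A f xs) =
      interp (direct_product (map (quotient_algebra A) ds)) f (map (class_indices A ds) xs)"
    by (intro nth_equalityI) (simp_all add: class_indices_def direct_product_def o_def cong: map_cong)
qed

text \<open>The hypothesis \<open>solve\<close> is a Chinese remainder condition: any choice of classes, one for
  each congruence, has a common member.\<close>

lemma class_indices_surjective:
  assumes fin: "finite (universe A)" and ds: "set ds \<subseteq> congruences ar A"
    and solve: "\<And>a. \<forall>j<length ds. a j \<in> universe A \<Longrightarrow>
      \<exists>b\<in>universe A. \<forall>j<length ds. (b, a j) \<in> ds ! j"
  shows "class_indices A ds ` universe A = universe (direct_product (map (quotient_algebra A) ds))"
proof (intro subset_antisym subsetI)
  fix w assume w: "w \<in> universe (direct_product (map (quotient_algebra A) ds))"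
  have "\<forall>j. \<exists>a. j < length ds \<longrightarrow> a \<in> universe A \<and> w ! j = class_index A (ds ! j) a"
    using w by (auto simp: direct_product_def quotient_algebra_def)
  then obtain a where a: "\<And>j. j < length ds \<Longrightarrow> a j \<in> universe A"
    "\<And>j. j < length ds \<Longrightarrow> w ! j = class_index A (ds ! j) (a j)"
    by metis
  then obtain c where c: "c \<in> universe A" "\<forall>j<length ds. (c, a j) \<in> ds ! j"
    using solve[of a] by blast
  have "class_index A (ds ! j) c = w ! j" if "j < length ds" for j
    using class_index_nth_eq_iff[OF fin ds that c(1) a(1)[OF that]] a(2)[OF that] c(2) that by simp
  moreover have "length w = length ds" using w by (simp add: direct_product_def)
  ultimately have "w = class_indices A ds c"
    by (intro nth_equalityI) (simp_all add: class_indices_def)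
  then show "w \<in> class_indices A ds ` universe A" using c by blast
next
  fix w assume "w \<in> class_indices A ds ` universe A"
  then show "w \<in> universe (direct_product (map (quotient_algebra A) ds))"
    by (auto simp: class_indices_def direct_product_def quotient_algebra_def)
qed

lemma subalgebra_image:
  assumes A: "is_algebra ar A" and h: "morphism ar A B h"
  shows "subalgebra ar B (h ` universe A)"
  unfolding subalgebra_def is_algebra_def
proof (intro conjI allI impI)
  show "h ` universe A \<subseteq> universe B" using h by (simp add: morphism_def)
  fix f n ys
  assume *: "ar f = Some n \<and> length ys = n \<and> set ys \<subseteq> universe (B\<lparr>universe := h ` universe A\<rparr>)"
  then have "ys \<in> lists (h ` universe A)" by auto
  then obtain xs where xs: "ys = map h xs" "set xs \<subseteq> universe A"
    by (auto simp: lists_image)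
  then have "interp A f xs \<in> universe A" "h (interp A f xs) = interp B f ys"
    using * A h by (auto simp: is_algebra_def morphism_def)
  then show "interp (B\<lparr>universe := h ` universe A\<rparr>) f ys \<in>
      universe (B\<lparr>universe := h ` universe A\<rparr>)"
    by simp (metis image_eqI)
qed

section \<open>Full shifts over finite algebras\<close>

lemma shift_algebra_algebra:
  assumes A: "is_algebra ar A"
  shows "is_algebra ar (shift_algebra A)"
  unfolding is_algebra_def
proof (intro allI impI)
  fix f n xs
  assume *: "ar f = Some n \<and> length xs = n \<and> set xs \<subseteq> full_shift A"
  have "set (map (\<lambda>x. x i) xs) \<subseteq> universe A" for i
    using * by (auto simp: shift_algebra_def)
  then have "interp A f (map (\<lambda>x. x i) xs) \<in> universe A" for i
    using A * unfolding is_algebra_def by (metis length_map)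
  then show "interp (shift_algebra A) f xs \<in> full_shift A"
    by (simp add: shift_algebra_def)
qed

lemma compact_shift_space: "finite (universe A) \<Longrightarrow> compact_space (shift_topology A)"
  by (simp add: shift_topology_def compact_space_product_topology compact_space_discrete_topology)

lemma Hausdorff_shift_space: "Hausdorff_space (shift_topology A)"
  by (simp add: shift_topology_def Hausdorff_space_product_topology)

lemma shift_image_full_shift: "shift ` full_shift A = full_shift A"
proof
  show "shift ` full_shift A \<subseteq> full_shift A" by (auto simp: shift_algebra_def shift_def)
  show "full_shift A \<subseteq> shift ` full_shift A"
  proof
    fix x assume "x \<in> full_shift A"
    then have "(\<lambda>i. x (i - 1)) \<in> full_shift A" by (simp add: shift_algebra_def)
    moreover have "x = shift (\<lambda>i. x (i - 1))" by (simp add: shift_def)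
    ultimately show "x \<in> shift ` full_shift A" by blast
  qed
qed

lemma const_in_full_shift: "a \<in> universe A \<Longrightarrow> (\<lambda>_. a) \<in> full_shift A"
  by (simp add: shift_algebra_def)

lemma const_morphism: "morphism ar A (shift_algebra A) (\<lambda>a _. a)"
  by (auto simp: morphism_def shift_algebra_def o_def)

lemma eval_morphism: "morphism ar (shift_algebra A) A (\<lambda>x. x i)"
  by (auto simp: morphism_def shift_algebra_def)

lemma cellular_automaton_maps:
  "cellular_automaton A F \<Longrightarrow> x \<in> full_shift A \<Longrightarrow> F x \<in> full_shift A"
  using topspace_shift_topology[of A]
  by (auto simp: cellular_automaton_def continuous_map_def)

lemma shift_power_in_full_shift: "x \<in> full_shift A \<Longrightarrow> shift_power k x \<in> full_shift A"
  by (simp add: shift_algebra_def shift_power_def)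

lemma cellular_automaton_shift_power:
  assumes F: "cellular_automaton A F" and x: "x \<in> full_shift A"
  shows "F (shift_power k x) = shift_power k (F x)"
proof -
  have nat: "F (shift_power (int n) x) = shift_power (int n) (F x)" if "x \<in> full_shift A" for n x
  proof (induction n)
    case (Suc n)
    have "(shift ^^ n) x \<in> full_shift A"
      using that by (metis shift_power_in_full_shift shift_power_of_nat)
    then show ?case using F Suc
      by (simp add: cellular_automaton_def shift_power_of_nat del: of_nat_Suc)
  qed (simp add: shift_power_def)
  show ?thesis
  proof (cases "k \<ge> 0")
    case True
    then show ?thesis using nat[OF x, of "nat k"] by simp
  next
    case False
    let ?y = "shift_power k x"
    have "F (shift_power (- k) ?y) = shift_power (- k) (F ?y)"
      using nat[OF shift_power_in_full_shift[OF x], of "nat (- k)" k] False by simp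
    then have "shift_power k (F x) = shift_power k (shift_power (- k) (F ?y))"
      by (simp only: shift_power_uminus)
    then show ?thesis by (simp add: shift_power_def)
  qed
qed

lemma cellular_automaton_at:
  assumes "cellular_automaton A F" "x \<in> full_shift A"
  shows "F x i = F (shift_power i x) 0"
  using cellular_automaton_shift_power[OF assms, of i] by (simp add: shift_power_def)

lemma cellular_automaton_const:
  assumes F: "cellular_automaton A F" and a: "a \<in> universe A"
  shows "F (\<lambda>_. a) = (\<lambda>_. F (\<lambda>_. a) 0)"
proof
  fix i
  show "F (\<lambda>_. a) i = F (\<lambda>_. a) 0"
    using cellular_automaton_at[OF F const_in_full_shift[OF a], of i]
    by (simp add: shift_power_def)
qed

lemma linear_cellular_automaton_funpow:
  assumes G: "linear_cellular_automaton ar A G"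
  shows "linear_cellular_automaton ar A (G ^^ n)"
proof (induction n)
  case 0
  show ?case
    by (simp add: linear_cellular_automaton_def cellular_automaton_def morphism_def)
next
  case (Suc n)
  then have "cellular_automaton A (G ^^ n)" by (simp add: linear_cellular_automaton_def)
  note maps = cellular_automaton_maps[OF this]
  have "continuous_map (shift_topology A) (shift_topology A) (G \<circ> G ^^ n)"
    using G Suc unfolding linear_cellular_automaton_def cellular_automaton_def
    by (blast intro: continuous_map_compose)
  moreover have "morphism ar (shift_algebra A) (shift_algebra A) (G \<circ> G ^^ n)"
    using G Suc unfolding linear_cellular_automaton_def by (blast intro: morphism_comp)
  ultimately show ?case
    using G Suc maps unfolding linear_cellular_automaton_def cellular_automaton_def
    by (auto simp only: funpow.simps o_apply)
qed

text \<open>This is the Curtis-Hedlund-Lyndon theorem.  By continuity the letter \<open>F x 0\<close> is constant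
  on a basic open set around \<open>x\<close>, which restricts only finitely many cells; finitely many of
  these sets cover the compact space, and the window contains all cells that they restrict.\<close>

lemma finite_window:
  assumes fin: "finite (universe A)" and F: "cellular_automaton A F"
  shows "\<exists>r::nat. \<forall>x\<in>full_shift A. \<forall>y\<in>full_shift A.
    (\<forall>i. \<bar>i\<bar> \<le> int r \<longrightarrow> x i = y i) \<longrightarrow> F x 0 = F y 0"
proof -
  let ?T = "shift_topology A"
  have F0: "continuous_map ?T (discrete_topology (universe A)) (\<lambda>x. F x 0)"
    using F unfolding cellular_automaton_def shift_topology_def
    by (simp add: continuous_map_componentwise_UNIV)
  have "\<exists>U. finite {i. U i \<noteq> universe A} \<and> (\<forall>i. U i \<subseteq> universe A) \<and> x \<in> Pi\<^sub>E UNIV U \<and>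
      (\<forall>y\<in>Pi\<^sub>E UNIV U. F y 0 = F x 0)" if x: "x \<in> full_shift A" for x
  proof -
    have "openin ?T {y \<in> topspace ?T. F y 0 \<in> {F x 0}}"
      using cellular_automaton_maps[OF F x]
      by (intro openin_continuous_map_preimage[OF F0]) (simp add: shift_algebra_def)
    moreover have "x \<in> {y \<in> topspace ?T. F y 0 \<in> {F x 0}}"
      using x by (simp add: topspace_shift_topology)
    ultimately obtain U where "finite {i \<in> UNIV. U i \<noteq> topspace (discrete_topology (universe A))}"
      "\<forall>i\<in>UNIV. openin (discrete_topology (universe A)) (U i)" "x \<in> Pi\<^sub>E UNIV U"
      "Pi\<^sub>E UNIV U \<subseteq> {y \<in> topspace ?T. F y 0 \<in> {F x 0}}"
      unfolding shift_topology_def openin_product_topology_alt by blast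
    then show ?thesis by (intro exI[of _ U]) auto
  qed
  then obtain U where U: "\<And>x. x \<in> full_shift A \<Longrightarrow> finite {i. U x i \<noteq> universe A} \<and>
      (\<forall>i. U x i \<subseteq> universe A) \<and> x \<in> Pi\<^sub>E UNIV (U x) \<and> (\<forall>y\<in>Pi\<^sub>E UNIV (U x). F y 0 = F x 0)"
    by metis
  let ?\<U> = "(\<lambda>x. Pi\<^sub>E UNIV (U x)) ` full_shift A"
  have "\<forall>W\<in>?\<U>. openin ?T W"
  proof
    fix W assume "W \<in> ?\<U>"
    then obtain x where x: "x \<in> full_shift A" "W = Pi\<^sub>E UNIV (U x)" by blast
    then show "openin ?T W"
      using U[OF x(1)] unfolding x(2) shift_topology_def by (intro product_topology_basis) auto
  qed
  moreover have "topspace ?T \<subseteq> \<Union>?\<U>"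
  proof
    fix x assume "x \<in> topspace ?T"
    then have "x \<in> full_shift A" by (simp add: topspace_shift_topology)
    then show "x \<in> \<Union>?\<U>" using U[of x] by (intro UnionI[of "Pi\<^sub>E UNIV (U x)"]) auto
  qed
  ultimately obtain \<F> where \<F>: "finite \<F>" "\<F> \<subseteq> ?\<U>" "topspace ?T \<subseteq> \<Union>\<F>"
    using compact_shift_space[OF fin, unfolded compact_space_alt, rule_format, of ?\<U>] by blast
  obtain C where C: "C \<subseteq> full_shift A" "finite C" "\<F> = (\<lambda>x. Pi\<^sub>E UNIV (U x)) ` C"
    using finite_subset_image[OF \<F>(1,2)] by blast
  define I where "I = (\<Union>x\<in>C. {i. U x i \<noteq> universe A})"
  have "finite I" unfolding I_def using C(1,2) U by (intro finite_UN_I) auto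
  then obtain r :: nat where r: "\<And>i. i \<in> I \<Longrightarrow> \<bar>i\<bar> \<le> int r"
    by (metis finite_imageI finite_nat_set_iff_bounded_le imageI nat_le_iff)
  have "F x 0 = F y 0" if x: "x \<in> full_shift A" and y: "y \<in> full_shift A"
    and xy: "\<forall>i. \<bar>i\<bar> \<le> int r \<longrightarrow> x i = y i" for x y
  proof -
    obtain c where c: "c \<in> C" "x \<in> Pi\<^sub>E UNIV (U c)" using \<F>(3) x unfolding C(3) topspace_shift_topology by blast
    have "y i \<in> U c i" for i
    proof (cases "i \<in> I")
      case True
      then show ?thesis using r xy c(2) by (metis PiE_iff UNIV_I)
    next
      case False
      then show ?thesis using y c(1) by (simp add: I_def shift_algebra_def)
    qed
    then have "y \<in> Pi\<^sub>E UNIV (U c)" by (simp add: PiE_iff)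
    then show ?thesis using U[OF subsetD[OF C(1) c(1)]] c(2) by metis
  qed
  then show ?thesis by blast
qed

section \<open>Congruences seen through a window\<close>

text \<open>A word over a window is extended to a configuration by repeating its end letters: every cell
  copies a letter of the word, so the extension is a morphism and needs no distinguished element.\<close>

definition extend_word :: "nat \<Rightarrow> 'a list \<Rightarrow> int \<Rightarrow> 'a" where
  "extend_word r w i = w ! nat (max (- int r) (min (int r) i) + int r)"

lemma extend_word_morphism:
  "morphism ar (direct_product (replicate (2 * r + 1) A)) (shift_algebra A) (extend_word r)"
proof -
  have "nat (max (- int r) (min (int r) i) + int r) < 2 * r + 1" for i by auto
  then show ?thesis
    unfolding morphism_def direct_product_def shift_algebra_def extend_word_def
    by (auto simp: o_def fun_eq_iff simp del: upt_Suc replicate_Suc)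
qed

text \<open>Reading a word over the window, extending it and applying \<open>F\<close> gives a morphism from a
  finite power of \<open>A\<close> to \<open>A\<close>.  The pullback of \<open>\<kappa>\<close> along it is a congruence
  on that power, and the congruence-product property splits it into the list \<open>ds\<close>, whose
  \<open>j\<close>-th entry belongs to the cell \<open>j - r\<close> of the window.\<close>

lemma congruence_through_window:
  assumes E: "wf_identities ar E" and cpp: "congruence_product_property ar E"
    and A: "in_variety ar E A" and F: "linear_cellular_automaton ar A F"
    and r: "\<forall>x\<in>full_shift A. \<forall>y\<in>full_shift A.
      (\<forall>i. \<bar>i\<bar> \<le> int r \<longrightarrow> x i = y i) \<longrightarrow> F x 0 = F y 0"
    and \<kappa>: "\<kappa> \<in> congruences ar A"
  shows "\<exists>ds. length ds = 2 * r + 1 \<and> set ds \<subseteq> congruences ar A \<and>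
    (\<forall>x\<in>full_shift A. \<forall>y\<in>full_shift A. \<forall>i. (F x i, F y i) \<in> \<kappa> \<longleftrightarrow>
      (\<forall>j<2 * r + 1. (x (i + (int j - int r)), y (i + (int j - int r))) \<in> ds ! j))"
proof -
  define n where "n = 2 * r + 1"
  let ?P = "direct_product (replicate n A)"
  define h where "h = (\<lambda>w. F (extend_word r w) 0)"
  have alg: "is_algebra ar A" using A by (simp add: in_variety_def)
  have algP: "is_algebra ar ?P" using alg by (intro direct_product_algebra) auto
  have CA: "cellular_automaton A F" and morF: "morphism ar (shift_algebra A) (shift_algebra A) F"
    using F by (auto simp: linear_cellular_automaton_def)
  have "morphism ar ?P A ((\<lambda>x. x 0) \<circ> (F \<circ> extend_word r))"
    unfolding n_def by (rule morphism_comp[OF morphism_comp[OF extend_word_morphism morF] eval_morphism])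
  then have "morphism ar ?P A h" by (simp add: h_def o_def)
  from pullback_congruence[OF algP this \<kappa>]
  have "pullback ?P h \<kappa> \<in> congruences ar ?P" .
  moreover have "congruences_factor ar (replicate n A)"
    using A by (intro congruence_product_propertyD[OF E cpp]) auto
  ultimately obtain ds where ds: "pullback ?P h \<kappa> = prod_congruence (replicate n A) ds"
    "length ds = n" "\<And>j. j < n \<Longrightarrow> ds ! j \<in> congruences ar A"
    unfolding congruences_factor_def by auto
  have zero: "(F x 0, F y 0) \<in> \<kappa> \<longleftrightarrow> (\<forall>j<n. (x (int j - int r), y (int j - int r)) \<in> ds ! j)"
    if x: "x \<in> full_shift A" and y: "y \<in> full_shift A" for x y
  proof -
    define word :: "(int \<Rightarrow> 'b) \<Rightarrow> 'b list" where
      "word z = map (\<lambda>j. z (int j - int r)) [0..<n]" for z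
    have wU: "word z \<in> universe ?P" and hw: "h (word z) = F z 0"
      if z: "z \<in> full_shift A" for z
    proof -
      show wU: "word z \<in> universe ?P"
        using z by (simp add: word_def direct_product_def shift_algebra_def)
      have "extend_word r (word z) \<in> full_shift A"
        using wU extend_word_morphism[of ar r A] by (auto simp: morphism_def n_def)
      moreover have "extend_word r (word z) i = z i" if i: "\<bar>i\<bar> \<le> int r" for i
      proof -
        have "nat (i + int r) < n" using i by (simp add: n_def)
        moreover have "i + int r \<ge> 0" using i by linarith
        ultimately show ?thesis using i by (simp add: extend_word_def word_def)
      qed
      ultimately show "h (word z) = F z 0" unfolding h_def using z r by blast
    qed
    have "(F x 0, F y 0) \<in> \<kappa> \<longleftrightarrow> (word x, word y) \<in> pullback ?P h \<kappa>"
      using x y wU hw by (simp add: pullback_def)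
    also have "\<dots> \<longleftrightarrow> (\<forall>j<n. (x (int j - int r), y (int j - int r)) \<in> ds ! j)"
      unfolding ds(1) using wU[OF x] wU[OF y] by (simp add: prod_congruence_def word_def)
    finally show ?thesis .
  qed
  have "(F x i, F y i) \<in> \<kappa> \<longleftrightarrow>
      (\<forall>j<n. (x (i + (int j - int r)), y (i + (int j - int r))) \<in> ds ! j)"
    if x: "x \<in> full_shift A" and y: "y \<in> full_shift A" for x y i
    using zero[OF shift_power_in_full_shift[OF x, of i] shift_power_in_full_shift[OF y, of i]]
      cellular_automaton_at[OF CA x, of i] cellular_automaton_at[OF CA y, of i]
    by (simp add: shift_power_def add.commute)
  moreover have "set ds \<subseteq> congruences ar A" using ds(2,3) by (auto simp: in_set_conv_nth)
  ultimately show ?thesis using ds(2) unfolding n_def by blast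
qed

section \<open>Cellular automata that are idempotent on constant configurations\<close>

text \<open>By the pigeonhole principle the powers of \<open>b\<close> are eventually periodic, with period
  \<open>t\<close> from exponent \<open>i\<close> on; any positive multiple of \<open>t\<close> that is at least \<open>i\<close>
  serves as \<open>N\<close>.\<close>

lemma idempotent_power:
  assumes fin: "finite S" and b: "b ` S \<subseteq> S"
  shows "\<exists>N\<ge>1. \<forall>a\<in>S. (b ^^ N) ((b ^^ N) a) = (b ^^ N) a"
proof -
  have maps: "(b ^^ m) a \<in> S" if "a \<in> S" for a m
    using that b by (induction m) auto
  have "range (\<lambda>m. restrict (b ^^ m) S) \<subseteq> S \<rightarrow>\<^sub>E S" using maps by auto
  then have "finite (range (\<lambda>m. restrict (b ^^ m) S))"
    using fin by (meson finite_PiE finite_subset)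
  then have "\<not> inj (\<lambda>m. restrict (b ^^ m) S)" using finite_imageD infinite_UNIV_nat by blast
  then obtain i j where "i \<noteq> j" "restrict (b ^^ i) S = restrict (b ^^ j) S"
    by (auto simp: inj_def)
  then obtain i j where ij: "i < j" "restrict (b ^^ i) S = restrict (b ^^ j) S"
    by (metis nat_neq_iff)
  define t where "t = j - i"
  have add: "(b ^^ m) ((b ^^ n) a) = (b ^^ (m + n)) a" for m n a by (simp add: funpow_add)
  have t: "t \<ge> 1" using ij by (simp add: t_def)
  have step: "(b ^^ (k + t)) a = (b ^^ k) a" if "i \<le> k" "a \<in> S" for k a
  proof -
    have "(b ^^ (k + t)) a = (b ^^ (k - i)) ((b ^^ j) a)"
      using that ij by (simp add: t_def add)
    also have "(b ^^ j) a = (b ^^ i) a" using ij(2) that(2) by (metis restrict_apply')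
    also have "(b ^^ (k - i)) ((b ^^ i) a) = (b ^^ k) a"
      using that by (simp add: add)
    finally show ?thesis .
  qed
  have mult: "(b ^^ (k + t * c)) a = (b ^^ k) a" if "i \<le> k" "a \<in> S" for k a c
  proof (induction c)
    case (Suc c)
    then show ?case using step[of "k + t * c" a] that by (simp add: algebra_simps)
  qed simp
  define N where "N = t * (i + 1)"
  have "1 * (i + 1) \<le> N" unfolding N_def using t by (intro mult_right_mono) auto
  then have "i \<le> N" "1 \<le> N" by simp_all
  then have "(b ^^ N) ((b ^^ N) a) = (b ^^ N) a" if "a \<in> S" for a
    using mult[of N a "i + 1"] that by (simp add: N_def funpow_add)
  then show ?thesis using \<open>1 \<le> N\<close> by blast
qed

text \<open>The heart of the argument.  Each congruence \<open>ds ! j\<close> is a coordinate on letters, which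
  \<open>F\<close> moves by \<open>ks ! j\<close> cells.  Idempotence on constants is what makes the letter
  \<open>F x i\<close> itself a solution of the congruences imposed by the letters of \<open>x\<close> around the
  cell \<open>i\<close>: both \<open>x\<close> and the constant configuration \<open>F x i\<close> yield
  \<open>\<theta>\<close>-related letters at \<open>i\<close>, and the \<open>ds ! j\<close> are obtained by pulling
  back \<open>\<theta>\<close> through the window.\<close>

lemma coordinates_of_idempotent_on_constants:
  assumes E: "wf_identities ar E" and cpp: "congruence_product_property ar E"
    and A: "in_variety ar E A" and fin: "finite (universe A)"
    and F: "linear_cellular_automaton ar A F"
    and idem: "\<forall>a\<in>universe A. F (F (\<lambda>_. a)) = F (\<lambda>_. a)"
  shows "\<exists>ks ds. length ks = length ds \<and> set ds \<subseteq> congruences ar A \<and>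
    (\<forall>a. (\<forall>j<length ds. a j \<in> universe A) \<longrightarrow>
       (\<exists>b\<in>universe A. \<forall>j<length ds. (b, a j) \<in> ds ! j)) \<and>
    (\<forall>x\<in>full_shift A. \<forall>y\<in>full_shift A.
       F x = F y \<longleftrightarrow> (\<forall>i. \<forall>j<length ds. (x i, y i) \<in> ds ! j)) \<and>
    (\<forall>x\<in>full_shift A. \<forall>i. \<forall>j<length ds. (F x i, x (i + ks ! j)) \<in> ds ! j)"
proof -
  let ?U = "universe A"
  have alg: "is_algebra ar A" using A by (simp add: in_variety_def)
  have CA: "cellular_automaton A F" and morF: "morphism ar (shift_algebra A) (shift_algebra A) F"
    using F by (auto simp: linear_cellular_automaton_def)
  have Fin: "F x i \<in> ?U" if "x \<in> full_shift A" for x i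
    using cellular_automaton_maps[OF CA that] by (simp add: shift_algebra_def)
  define e where "e = (\<lambda>a. F (\<lambda>_. a) 0)"
  have Fe: "F (\<lambda>_. a) = (\<lambda>_. e a)" if "a \<in> ?U" for a
    unfolding e_def by (rule cellular_automaton_const[OF CA that])
  have eU: "e a \<in> ?U" if "a \<in> ?U" for a
    unfolding e_def using Fin const_in_full_shift[OF that] .
  have ee: "e (e a) = e a" if a: "a \<in> ?U" for a
    using idem[rule_format, OF a] Fe[OF a] Fe[OF eU[OF a]] by metis
  have "morphism ar A A ((\<lambda>x. x 0) \<circ> (F \<circ> (\<lambda>a _. a)))"
    by (rule morphism_comp[OF morphism_comp[OF const_morphism morF] eval_morphism])
  then have "morphism ar A A e" by (simp add: e_def o_def)
  define \<theta> where "\<theta> = pullback A e (Id_on ?U)"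
  have \<theta>c: "\<theta> \<in> congruences ar A"
    unfolding \<theta>_def by (rule pullback_congruence) (fact | rule Id_on_congruence alg)+
  have \<theta>: "(a, b) \<in> \<theta> \<longleftrightarrow> e a = e b" if "a \<in> ?U" "b \<in> ?U" for a b
    using that eU by (simp add: \<theta>_def pullback_def Id_on_iff)
  obtain r where r: "\<forall>x\<in>full_shift A. \<forall>y\<in>full_shift A.
      (\<forall>i. \<bar>i\<bar> \<le> int r \<longrightarrow> x i = y i) \<longrightarrow> F x 0 = F y 0"
    using finite_window[OF fin CA] by blast
  note window = congruence_through_window[OF E cpp A F r]
  obtain cs where cs: "length cs = 2 * r + 1" "set cs \<subseteq> congruences ar A"
    "\<forall>x\<in>full_shift A. \<forall>y\<in>full_shift A. \<forall>i. (F x i, F y i) \<in> Id_on ?U \<longleftrightarrow>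
      (\<forall>j<2 * r + 1. (x (i + (int j - int r)), y (i + (int j - int r))) \<in> cs ! j)"
    using window[OF Id_on_congruence[OF alg]] by (elim exE conjE)
  note cs_iff = cs(3)[rule_format]
  obtain ds where ds: "length ds = 2 * r + 1" "set ds \<subseteq> congruences ar A"
    "\<forall>x\<in>full_shift A. \<forall>y\<in>full_shift A. \<forall>i. (F x i, F y i) \<in> \<theta> \<longleftrightarrow>
      (\<forall>j<2 * r + 1. (x (i + (int j - int r)), y (i + (int j - int r))) \<in> ds ! j)"
    using window[OF \<theta>c] by (elim exE conjE)
  note ds_iff = ds(3)[rule_format]
  \<comment> \<open>Both lists of congruences meet in \<open>\<theta>\<close>, as seen by inserting constant configurations.\<close>
  have cs_\<theta>: "(\<forall>j<2 * r + 1. (a, b) \<in> cs ! j) \<longleftrightarrow> (a, b) \<in> \<theta>" if "a \<in> ?U" "b \<in> ?U" for a b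
    using cs_iff[OF const_in_full_shift const_in_full_shift, OF that, of 0] that eU \<theta>
    by (simp add: Fe Id_on_iff)
  have ds_\<theta>: "(\<forall>j<2 * r + 1. (a, b) \<in> ds ! j) \<longleftrightarrow> (a, b) \<in> \<theta>" if "a \<in> ?U" "b \<in> ?U" for a b
    using ds_iff[OF const_in_full_shift const_in_full_shift, OF that, of 0] that eU \<theta> ee
    by (simp add: Fe)
  have kernel: "F x = F y \<longleftrightarrow> (\<forall>i. (x i, y i) \<in> \<theta>)"
    if x: "x \<in> full_shift A" and y: "y \<in> full_shift A" for x y
  proof -
    have xU: "x i \<in> ?U" "y i \<in> ?U" for i using x y by (auto simp: shift_algebra_def)
    have "F x = F y \<longleftrightarrow> (\<forall>i. (F x i, F y i) \<in> Id_on ?U)"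
      using Fin[OF x] by (auto simp: fun_eq_iff Id_on_iff)
    also have "\<dots> \<longleftrightarrow>
        (\<forall>i. \<forall>j<2 * r + 1. (x (i + (int j - int r)), y (i + (int j - int r))) \<in> cs ! j)"
      using cs_iff[OF x y] by blast
    also have "\<dots> \<longleftrightarrow> (\<forall>i. \<forall>j<2 * r + 1. (x i, y i) \<in> cs ! j)"
    proof (intro iffI allI impI)
      fix i j assume "\<forall>i. \<forall>j<2 * r + 1. (x (i + (int j - int r)), y (i + (int j - int r))) \<in> cs ! j"
        and "j < 2 * r + 1"
      then have "(x (i - (int j - int r) + (int j - int r)), y (i - (int j - int r) + (int j - int r)))
          \<in> cs ! j" by blast
      then show "(x i, y i) \<in> cs ! j" by simp
    qed simp
    also have "\<dots> \<longleftrightarrow> (\<forall>i. (x i, y i) \<in> \<theta>)" using cs_\<theta> xU by blast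
    finally show ?thesis .
  qed
  have displaced: "(F x i, x (i + (int j - int r))) \<in> ds ! j"
    if x: "x \<in> full_shift A" and j: "j < 2 * r + 1" for x i j
  proof -
    let ?c = "F x i"
    have c: "?c \<in> ?U" using Fin[OF x] .
    have "(F (\<lambda>_. ?c) i, F x i) \<in> \<theta>"
      using \<theta>[OF eU[OF c] c] ee[OF c] by (simp add: Fe[OF c])
    then show ?thesis using ds_iff[OF const_in_full_shift[OF c] x] j by blast
  qed
  show ?thesis
  proof (rule exI[of _ "map (\<lambda>j. int j - int r) [0..<2 * r + 1]"], rule exI[of _ ds],
      intro conjI allI impI ballI)
    show "F x = F y \<longleftrightarrow> (\<forall>i. \<forall>j<length ds. (x i, y i) \<in> ds ! j)"
      if x: "x \<in> full_shift A" and y: "y \<in> full_shift A" for x y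
      unfolding kernel[OF x y] ds(1)
      using ds_\<theta> x y by (simp add: shift_algebra_def)
    show "(F x i, x (i + map (\<lambda>j. int j - int r) [0..<2 * r + 1] ! j)) \<in> ds ! j"
      if "x \<in> full_shift A" "j < length ds" for x i j
      using displaced[OF that(1), of j i] that(2) unfolding ds(1) by (simp del: upt_Suc)
    show "\<exists>b\<in>?U. \<forall>j<length ds. (b, a j) \<in> ds ! j" if a: "\<forall>j<length ds. a j \<in> ?U" for a
    proof -
      \<comment> \<open>The configuration reads \<open>a 0\<close>, ..., \<open>a (2 * r)\<close> in the window; the truncation
        at both ends only keeps its letters in the universe.\<close>
      define x where "x i = a (min (2 * r) (nat (i + int r)))" for i
      have x: "x \<in> full_shift A" using a ds(1) by (simp add: x_def shift_algebra_def)
      have "x (int j - int r) = a j" if "j < 2 * r + 1" for j using that by (simp add: x_def)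
      then have "\<forall>j<length ds. (F x 0, a j) \<in> ds ! j"
        using displaced[OF x, of _ 0] ds(1) by simp
      then show ?thesis using Fin[OF x] by blast
    qed
    show "length (map (\<lambda>j. int j - int r) [0..<2 * r + 1]) = length ds" by (simp add: ds(1))
    show "set ds \<subseteq> congruences ar A" by (rule ds(2))
  qed
qed

section \<open>The limit set and its conjugacy to a product of full shifts\<close>

lemma subshift_image:
  assumes fin: "finite (universe A)" and F: "cellular_automaton A F"
  shows "subshift A (F ` full_shift A)"
proof -
  have cont: "continuous_map (shift_topology A) (shift_topology A) F"
    using F by (simp add: cellular_automaton_def)
  have "closed_map (shift_topology A) (shift_topology A) F"
    by (rule T1_Spaces.continuous_imp_closed_map
        [OF cont compact_shift_space[OF fin] Hausdorff_shift_space])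
  then have "closedin (shift_topology A) (F ` full_shift A)"
    unfolding closed_map_def using closedin_topspace topspace_shift_topology by metis
  moreover have "shift ` F ` full_shift A = F ` shift ` full_shift A"
    using F by (force simp: cellular_automaton_def image_image)
  ultimately show ?thesis by (simp add: subshift_def shift_image_full_shift)
qed

text \<open>If \<open>G ^^ N\<close> maps its image onto itself, the images of the powers of \<open>G\<close>, which form a
  decreasing sequence, do not shrink after the \<open>N\<close>-th one.\<close>

lemma limit_set_stable:
  assumes G: "cellular_automaton A G" and N: "N \<ge> 1"
    and stab: "(G ^^ N) ` full_shift A \<subseteq> (G ^^ N) ` (G ^^ N) ` full_shift A"
  shows "limit_set A G = (G ^^ N) ` full_shift A"
proof -
  let ?U = "full_shift A"
  have GU: "(G ^^ m) ` ?U \<subseteq> ?U" for m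
    using cellular_automaton_maps[OF G] by (induction m) auto
  have mono: "(G ^^ (k + m)) ` ?U \<subseteq> (G ^^ k) ` ?U" for k m
    using GU[of m] by (auto simp: funpow_add image_comp[symmetric])
  have iter: "(G ^^ N) ` ?U \<subseteq> (G ^^ (N * Suc c)) ` ?U" for c
  proof (induction c)
    case (Suc c)
    have "(G ^^ N) ` (G ^^ N) ` ?U \<subseteq> (G ^^ N) ` (G ^^ (N * Suc c)) ` ?U"
      using Suc by (rule image_mono)
    also have "\<dots> = (G ^^ (N * Suc (Suc c))) ` ?U"
      by (simp add: funpow_add image_comp)
    finally show ?case using stab by blast
  qed simp
  have "(G ^^ N) ` ?U \<subseteq> (G ^^ n) ` ?U" for n
  proof -
    have "n \<le> N * Suc n" using N by (cases N) auto
    then show ?thesis using iter[of n] mono[of n "N * Suc n - n"] by simp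
  qed
  then show ?thesis unfolding limit_set_def by blast
qed

text \<open>An isomorphism theorem: \<open>F\<close> and the cellwise application of \<open>q\<close> are morphisms with the
  same kernel, so their images are isomorphic.  The isomorphism is continuous because \<open>F\<close>,
  from a compact space to a Hausdorff space, is a quotient map onto its image.\<close>

lemma algebraic_conjugacy_of_kernel:
  assumes A: "is_algebra ar A" and fin: "finite (universe A)"
    and F: "linear_cellular_automaton ar A F"
    and B: "is_algebra ar B" and q: "morphism ar A B q" and surj: "q ` universe A = universe B"
    and ker: "\<And>x y. x \<in> full_shift A \<Longrightarrow> y \<in> full_shift A \<Longrightarrow> F x = F y \<longleftrightarrow> q \<circ> x = q \<circ> y"
  shows "\<exists>\<phi>. algebraic_conjugacy ar A (F ` full_shift A) B (full_shift B) \<phi> \<and>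
    (\<forall>x\<in>full_shift A. \<phi> (F x) = q \<circ> x)"
proof -
  let ?U = "full_shift A" and ?V = "full_shift B" and ?TA = "shift_topology A"
    and ?TB = "shift_topology B"
  let ?X = "F ` ?U"
  have CA: "cellular_automaton A F" and morF: "morphism ar (shift_algebra A) (shift_algebra A) F"
    using F by (auto simp: linear_cellular_automaton_def)
  define \<phi> where "\<phi> y = q \<circ> inv_into ?U F y" for y
  have \<phi>: "\<phi> (F x) = q \<circ> x" if x: "x \<in> ?U" for x
  proof -
    have "inv_into ?U F (F x) \<in> ?U" "F (inv_into ?U F (F x)) = F x"
      using x by (auto simp: inv_into_into f_inv_into_f)
    then show ?thesis using ker x unfolding \<phi>_def by blast
  qed
  have qU: "q \<circ> x \<in> ?V" if "x \<in> ?U" for x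
    using that surj by (auto simp: shift_algebra_def)
  have "\<exists>x\<in>?U. q \<circ> x = y" if y: "y \<in> ?V" for y
  proof
    have y: "y i \<in> q ` universe A" for i using y surj by (simp add: shift_algebra_def)
    show "inv_into (universe A) q \<circ> y \<in> ?U"
      using y by (simp add: shift_algebra_def inv_into_into)
    show "q \<circ> (inv_into (universe A) q \<circ> y) = y"
      using y by (simp add: fun_eq_iff f_inv_into_f)
  qed
  then have "\<phi> ` ?X = ?V" using \<phi> qU by (force simp: image_image)
  moreover have "inj_on \<phi> ?X" using \<phi> ker by (auto simp: inj_on_def)
  ultimately have "bij_betw \<phi> ?X ?V" by (simp add: bij_betw_def)
  moreover have "continuous_map (subtopology ?TA ?X) (subtopology ?TB ?V) \<phi>"
  proof (rule continuous_compose_quotient_map)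
    have cont: "continuous_map ?TA (subtopology ?TA ?X) F"
      using CA by (auto simp: cellular_automaton_def continuous_map_in_subtopology
          topspace_shift_topology)
    show "quotient_map ?TA (subtopology ?TA ?X) F"
      using cellular_automaton_maps[OF CA]
      by (intro T1_Spaces.continuous_imp_quotient_map[OF cont compact_shift_space[OF fin]])
        (auto simp: Hausdorff_space_subtopology Hausdorff_shift_space topspace_shift_topology)
    have "continuous_map ?TA (discrete_topology (universe B)) (\<lambda>x. q (x i))" for i
    proof -
      have "continuous_map ?TA (discrete_topology (universe A)) (\<lambda>x. x i)"
        unfolding shift_topology_def by (intro continuous_map_product_projection) simp
      moreover have "continuous_map (discrete_topology (universe A))
          (discrete_topology (universe B)) q"
        using surj by auto
      ultimately have "continuous_map ?TA (discrete_topology (universe B)) (q \<circ> (\<lambda>x. x i))"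
        by (rule continuous_map_compose)
      then show ?thesis by (simp add: o_def)
    qed
    then have "continuous_map ?TA ?TB (\<lambda>x. q \<circ> x)"
      by (simp add: shift_topology_def[of B] continuous_map_componentwise_UNIV)
    then have "continuous_map ?TA ?TB (\<phi> \<circ> F)"
      by (rule continuous_map_eq) (simp add: \<phi> topspace_shift_topology)
    then show "continuous_map ?TA (subtopology ?TB ?V) (\<phi> \<circ> F)"
      by (metis subtopology_topspace topspace_shift_topology)
  qed
  moreover have "\<phi> (shift y) = shift (\<phi> y)" if "y \<in> ?X" for y
  proof -
    from that obtain x where x: "x \<in> ?U" "y = F x" by blast
    then have "shift x \<in> ?U" "shift y = F (shift x)"
      using CA shift_image_full_shift[of A] by (auto simp: cellular_automaton_def)
    then have "\<phi> (shift y) = q \<circ> shift x" "\<phi> y = q \<circ> x" using x \<phi> by simp_all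
    then show ?thesis by (simp add: shift_def comp_def)
  qed
  moreover have "subshift B ?V"
    unfolding subshift_def shift_image_full_shift
    using closedin_topspace[of ?TB] by (simp add: topspace_shift_topology)
  ultimately have conj: "conjugacy A ?X B ?V \<phi>"
    using subshift_image[OF fin CA] by (simp add: conjugacy_def)
  have mor: "morphism ar (shift_algebra A\<lparr>universe := ?X\<rparr>) (shift_algebra B\<lparr>universe := ?V\<rparr>) \<phi>"
    unfolding morphism_def
  proof (intro conjI allI impI)
    show "\<phi> ` universe (shift_algebra A\<lparr>universe := ?X\<rparr>) \<subseteq> universe (shift_algebra B\<lparr>universe := ?V\<rparr>)"
      using \<open>\<phi> ` ?X = ?V\<close> by simp
    fix f n ys
    assume *: "ar f = Some n \<and> length ys = n \<and> set ys \<subseteq> universe (shift_algebra A\<lparr>universe := ?X\<rparr>)"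
    then have "ys \<in> lists ?X" by auto
    then obtain xs where xs: "ys = map F xs" "set xs \<subseteq> ?U"
      by (auto simp: lists_image)
    let ?x = "interp (shift_algebra A) f xs"
    have "?x \<in> ?U" "F ?x = interp (shift_algebra A) f ys"
      using * xs shift_algebra_algebra[OF A] morF by (auto simp: is_algebra_def morphism_def)
    then have "\<phi> (interp (shift_algebra A) f ys) = q \<circ> ?x" using \<phi> by metis
    also have "\<dots> = interp (shift_algebra B) f (map (\<lambda>x. q \<circ> x) xs)"
    proof
      fix i
      have "set (map (\<lambda>x. x i) xs) \<subseteq> universe A" using xs(2) by (auto simp: shift_algebra_def)
      then have "q (interp A f (map (\<lambda>x. x i) xs)) = interp B f (map q (map (\<lambda>x. x i) xs))"
        using q * xs(1) unfolding morphism_def by (metis length_map)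
      then show "(q \<circ> ?x) i = interp (shift_algebra B) f (map (\<lambda>x. q \<circ> x) xs) i"
        by (simp add: shift_algebra_def o_def)
    qed
    also have "map (\<lambda>x. q \<circ> x) xs = map \<phi> ys" using xs \<phi> by auto
    finally show "\<phi> (interp (shift_algebra A\<lparr>universe := ?X\<rparr>) f ys) =
        interp (shift_algebra B\<lparr>universe := ?V\<rparr>) f (map \<phi> ys)"
      by simp
  qed
  have "subalgebra ar (shift_algebra B) ?V"
    using shift_algebra_algebra[OF B] by (simp add: subalgebra_def)
  then have "algebraic_conjugacy ar A ?X B ?V \<phi>"
    using conj mor subalgebra_image[OF shift_algebra_algebra[OF A] morF]
    by (simp add: algebraic_conjugacy_def)
  then show ?thesis using \<phi> by blast
qed

theorem theorem4:
  fixes ar :: "'f signature" and E :: "'f identity set"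
    and S :: "('f, 'a) ualgebra" and G :: "(int \<Rightarrow> 'a) \<Rightarrow> int \<Rightarrow> 'a"
  assumes "wf_identities ar E"
    and "congruence_product_property ar E"
    and "in_variety ar E S"
    and "finite (universe S)"
    and "linear_cellular_automaton ar S G"
  shows "stable_ca S G \<and>
    (\<exists>(Rs :: ('f, nat) ualgebra list) \<phi>.
       (\<forall>R\<in>set Rs. in_variety ar E R \<and> finite (universe R)) \<and>
       algebraic_conjugacy ar S (limit_set S G)
         (direct_product Rs) (full_shift (direct_product Rs)) \<phi> \<and>
       (\<exists>p\<ge>1. \<exists>ks. length ks = length Rs \<and>
          (\<forall>y\<in>full_shift (direct_product Rs).
             \<phi> ((G ^^ p) (inv_into (limit_set S G) \<phi> y)) = prod_shift_powers ks y)))"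
proof -
  let ?U = "full_shift S"
  note E = assms(1) and cpp = assms(2) and S = assms(3) and fin = assms(4) and G = assms(5)
  have alg: "is_algebra ar S" using S by (simp add: in_variety_def)
  have CG: "cellular_automaton S G" using G by (simp add: linear_cellular_automaton_def)
  define b where "b a = G (\<lambda>_. a) 0" for a
  have Gb: "G (\<lambda>_. a) = (\<lambda>_. b a)" if "a \<in> universe S" for a
    unfolding b_def by (rule cellular_automaton_const[OF CG that])
  have bS: "b a \<in> universe S" if "a \<in> universe S" for a
    using cellular_automaton_maps[OF CG const_in_full_shift[OF that]]
    by (simp add: b_def shift_algebra_def)
  have Gn: "(G ^^ n) (\<lambda>_. a) = (\<lambda>_. (b ^^ n) a) \<and> (b ^^ n) a \<in> universe S"
    if "a \<in> universe S" for a n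
    using that Gb bS by (induction n) auto
  obtain N where N: "N \<ge> 1" "\<And>a. a \<in> universe S \<Longrightarrow> (b ^^ N) ((b ^^ N) a) = (b ^^ N) a"
    using idempotent_power[OF fin, of b] bS by blast
  define F where "F = G ^^ N"
  have F: "linear_cellular_automaton ar S F"
    unfolding F_def by (rule linear_cellular_automaton_funpow[OF G])
  then have CF: "cellular_automaton S F" by (simp add: linear_cellular_automaton_def)
  have idem: "\<forall>a\<in>universe S. F (F (\<lambda>_. a)) = F (\<lambda>_. a)"
    using Gn N(2) by (simp add: F_def)
  obtain ds ks where len: "length ks = length ds" and ds: "set ds \<subseteq> congruences ar S"
    and solve: "\<forall>a. (\<forall>j<length ds. a j \<in> universe S) \<longrightarrow>
       (\<exists>b\<in>universe S. \<forall>j<length ds. (b, a j) \<in> ds ! j)"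
    and ker: "\<forall>x\<in>?U. \<forall>y\<in>?U. F x = F y \<longleftrightarrow> (\<forall>i. \<forall>j<length ds. (x i, y i) \<in> ds ! j)"
    and displaced: "\<forall>x\<in>?U. \<forall>i. \<forall>j<length ds. (F x i, x (i + ks ! j)) \<in> ds ! j"
    using coordinates_of_idempotent_on_constants[OF E cpp S fin F idem] by (elim exE conjE)
  note solve = solve[rule_format] and ker = ker[rule_format] and displaced = displaced[rule_format]
  define Rs where "Rs = map (quotient_algebra S) ds"
  define q where "q = class_indices S ds"
  have q: "morphism ar S (direct_product Rs) q"
    unfolding q_def Rs_def by (rule class_indices_morphism[OF alg fin ds])
  have surj: "q ` universe S = universe (direct_product Rs)"
    unfolding q_def Rs_def using solve by (intro class_indices_surjective[OF fin ds]) blast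
  note q_eq = class_indices_eq_iff[OF fin ds]
  have Rs: "in_variety ar E R \<and> finite (universe R)" if "R \<in> set Rs" for R
  proof -
    from that obtain d where d: "d \<in> congruences ar S" "R = quotient_algebra S d"
      using ds by (auto simp: Rs_def)
    have "universe R = class_index S d ` universe S" by (simp add: d(2) quotient_algebra_def)
    then show ?thesis
      using in_variety_surjective_image[OF E S class_index_morphism[OF alg fin d(1)]] fin d(2)
      by simp
  qed
  have algB: "is_algebra ar (direct_product Rs)"
    using Rs by (intro direct_product_algebra) (auto simp: in_variety_def)
  have kerq: "F x = F y \<longleftrightarrow> q \<circ> x = q \<circ> y" if x: "x \<in> ?U" and y: "y \<in> ?U" for x y
  proof -
    have "q (x i) = q (y i) \<longleftrightarrow> (\<forall>j<length ds. (x i, y i) \<in> ds ! j)" for i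
      unfolding q_def using x y by (intro q_eq) (auto simp: shift_algebra_def)
    then show ?thesis using ker[OF x y] by (simp add: fun_eq_iff)
  qed
  from algebraic_conjugacy_of_kernel[OF alg fin F algB q surj kerq]
  obtain \<phi> where conj: "algebraic_conjugacy ar S (F ` ?U) (direct_product Rs)
      (full_shift (direct_product Rs)) \<phi>" and \<phi>: "\<And>x. x \<in> ?U \<Longrightarrow> \<phi> (F x) = q \<circ> x"
    by blast
  have qF: "q \<circ> F x = prod_shift_powers ks (q \<circ> x)" if x: "x \<in> ?U" for x
  proof -
    have "class_index S (ds ! j) (F x i) = class_index S (ds ! j) (x (i + ks ! j))"
      if "j < length ds" for i j
      using class_index_nth_eq_iff[OF fin ds that] displaced[OF x that]
        cellular_automaton_maps[OF CF x] x by (simp add: shift_algebra_def)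
    then show ?thesis
      by (auto simp: prod_shift_powers_def shift_power_def q_def class_indices_def fun_eq_iff len
          intro!: nth_equalityI)
  qed
  \<comment> \<open>A preimage of \<open>F x\<close> in the image of \<open>F\<close>: shift each coordinate of \<open>x\<close> back by the amount
    that \<open>F\<close> shifts it.\<close>
  have "F ` ?U \<subseteq> F ` F ` ?U"
  proof
    fix y assume "y \<in> F ` ?U"
    then obtain x where x: "x \<in> ?U" "y = F x" by blast
    have "\<exists>c\<in>universe S. \<forall>j<length ds. (c, x (i - ks ! j)) \<in> ds ! j" for i
      using x(1) by (intro solve) (simp add: shift_algebra_def)
    then obtain z where z: "\<And>i. z i \<in> universe S"
      "\<And>i j. j < length ds \<Longrightarrow> (z i, x (i - ks ! j)) \<in> ds ! j" by metis
    have zU: "z \<in> ?U" using z(1) by (simp add: shift_algebra_def)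
    have "(F z i, x i) \<in> ds ! j" if j: "j < length ds" for i j
    proof -
      have "ds ! j \<in> congruences ar S" using subsetD[OF ds nth_mem[OF j]] .
      then have "trans (ds ! j)" by (simp add: congruences_def equiv_def)
      moreover have "(z (i + ks ! j), x i) \<in> ds ! j" using z(2)[OF j, of "i + ks ! j"] by simp
      ultimately show ?thesis using displaced[OF zU j, of i] by (blast dest: transD)
    qed
    then have "F (F z) = y" using ker[OF cellular_automaton_maps[OF CF zU] x(1)] x(2) by blast
    moreover have "F (F z) \<in> F ` F ` ?U" by (intro imageI zU)
    ultimately show "y \<in> F ` F ` ?U" by simp
  qed
  then have limit: "limit_set S G = F ` ?U"
    unfolding F_def by (rule limit_set_stable[OF CG N(1)])
  have "\<phi> (F (inv_into (F ` ?U) \<phi> y)) = prod_shift_powers ks y"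
    if y: "y \<in> full_shift (direct_product Rs)" for y
  proof -
    have bij: "bij_betw \<phi> (F ` ?U) (full_shift (direct_product Rs))"
      using conj by (simp add: algebraic_conjugacy_def conjugacy_def)
    have "y \<in> \<phi> ` F ` ?U" using y bij_betw_imp_surj_on[OF bij] by simp
    then obtain x where x: "x \<in> ?U" "\<phi> (F x) = y" by (elim imageE) simp
    have "inv_into (F ` ?U) \<phi> y = F x"
      using x(2) inv_into_f_f[OF bij_betw_imp_inj_on[OF bij] imageI[OF x(1), of F]] by simp
    then show ?thesis
      using \<phi>[OF cellular_automaton_maps[OF CF x(1)]] \<phi>[OF x(1)] qF[OF x(1)] x(2) by simp
  qed
  then have "\<exists>p\<ge>1. \<exists>ks. length ks = length Rs \<and> (\<forall>y\<in>full_shift (direct_product Rs).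
      \<phi> ((G ^^ p) (inv_into (limit_set S G) \<phi> y)) = prod_shift_powers ks y)"
    unfolding limit using N(1) len
    by (intro exI[of _ N] conjI exI[of _ ks]) (auto simp: F_def Rs_def)
  moreover have "stable_ca S G" unfolding stable_ca_def using limit[unfolded F_def] by blast
  ultimately show ?thesis using Rs conj[folded limit] by blast
qed

end
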